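(* Let $k\ge1$ be an integer and let $\lambda\in\{\rho,q\}$. For the relevant integers $n,s$ put $H_{n,s}=K_s\vee(sK_1\cup K_{n-2s})$ and $L_{n,s}=K_{s-1}\vee(sK_1\cup K_{n-2s+1})$. (i) If $n\ge2k+1$, then $$\mathrm{spex}_\lambda(n,C_n;\delta\ge k)=\max_{k\le s\le\lfloor(n-1)/2\rfloor}\lambda(H_{n,s}),$$ and $$\mathrm{SPEX}_\lambda(n,C_n;\delta\ge k)=\left\{H_{n,s}: k\le s\le\lfloor(n-1)/2\rfloor,\ \lambda(H_{n,s})=\mathrm{spex}_\lambda(n,C_n;\delta\ge k)\right\}.$$ (ii) If $n\ge2k+2$, then $$\mathrm{spex}_\lambda(n,P_n;\delta\ge k)=\max_{k+1\le s\le\lfloor n/2\rfloor}\lambda(L_{n,s}),$$ and $$\mathrm{SPEX}_\lambda(n,P_n;\delta\ge k)=\left\{L_{n,s}: k+1\le s\le\lfloor n/2\rfloor,\ \lambda(L_{n,s})=\mathrm{spex}_\lambda(n,P_n;\delta\ge k)\right\}.$$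
   Context: All graphs are finite and simple; graph equality is up to isomorphism. $H_1\cup H_2$ denotes disjoint union and $H_1\vee H_2$ denotes join (disjoint union plus all edges between the two graphs); $sK_1$ is the edgeless graph on $s$ vertices. $\delta$ is the minimum degree. $C_n$ and $P_n$ are the cycle and the path with $n$ vertices. With $A(G)$ the adjacency matrix and $D(G)$ the diagonal degree matrix of $G$, $\rho(G)$ is the largest eigenvalue of $A(G)$ (spectral radius) and $q(G)$ is the largest eigenvalue of $Q(G)=D(G)+A(G)$ (signless Laplacian spectral radius). For a graph $F$ and $\lambda\in\{\rho,q\}$, $\mathrm{spex}_\lambda(n,F;\delta\ge k)$ is the maximum of $\lambda$ over all graphs of order $n$ and minimum degree at least $k$ that contain no copy of $F$ (as a subgraph), and $\mathrm{SPEX}_\lambda(n,F;\delta\ge k)$ is the family of all such graphs (up to isomorphism) attaining this maximum. *)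

theory Defs
  imports Graph_Theory.Graph_Theory Jordan_Normal_Form.Spectral_Radius
begin

text \<open>
  Finite simple graphs are symmetric loop-free digraphs without parallel arcs (\<^locale>\<open>pair_graph\<close>).
  Since graphs are considered up to isomorphism, a graph of order \<open>n\<close> is taken to have the
  vertex set \<open>{..<n}\<close>; the labels double as row and column indices of its matrices.
\<close>

type_synonym ngraph = "nat pair_pre_digraph"

definition graphs_of_order :: "nat \<Rightarrow> ngraph set" where
  "graphs_of_order n = {G. pair_graph G \<and> pverts G = {..<n}}"

definition graph_order :: "ngraph \<Rightarrow> nat" where
  "graph_order G = card (pverts G)"

definition iso_class :: "ngraph \<Rightarrow> ngraph set" where
  "iso_class G = {G' \<in> graphs_of_order (graph_order G). digraph_iso (with_proj G) (with_proj G')}"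

text \<open>Each edge is a pair of opposite arcs, so the degree of a vertex is its out-degree.\<close>

definition degree_of :: "ngraph \<Rightarrow> nat \<Rightarrow> nat" where
  "degree_of G v = out_degree (with_proj G) v"

definition min_degree :: "ngraph \<Rightarrow> nat" where
  "min_degree G = Min (degree_of G ` pverts G)"

definition contains_copy :: "ngraph \<Rightarrow> ngraph \<Rightarrow> bool" where
  "contains_copy F G \<longleftrightarrow> (\<exists>H. subgraph H (with_proj G) \<and> digraph_iso (with_proj F) H)"

definition complete_graph :: "nat \<Rightarrow> ngraph" where
  "complete_graph n = \<lparr>pverts = {..<n}, parcs = {(i, j). i < n \<and> j < n \<and> i \<noteq> j}\<rparr>"

definition edgeless_graph :: "nat \<Rightarrow> ngraph" where
  "edgeless_graph n = \<lparr>pverts = {..<n}, parcs = {}\<rparr>"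

definition path_graph :: "nat \<Rightarrow> ngraph" where
  "path_graph n = \<lparr>pverts = {..<n}, parcs = {(i, j). i < n \<and> j < n \<and> (j = Suc i \<or> i = Suc j)}\<rparr>"

text \<open>A simple cycle for \<open>n \<ge> 3\<close> only.\<close>

definition cycle_graph :: "nat \<Rightarrow> ngraph" where
  "cycle_graph n = \<lparr>pverts = {..<n},
     parcs = {(i, j). i < n \<and> j < n \<and> (j = Suc i mod n \<or> i = Suc j mod n)}\<rparr>"

text \<open>
  In disjoint unions and joins the second graph is relabelled by adding the order of the first,
  so that the vertex sets \<open>{..<m}\<close> and \<open>{..<n}\<close> combine to \<open>{..<m + n}\<close>.
\<close>

definition shift_graph :: "nat \<Rightarrow> ngraph \<Rightarrow> ngraph" where
  "shift_graph m G = \<lparr>pverts = (+) m ` pverts G, parcs = map_prod ((+) m) ((+) m) ` parcs G\<rparr>"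

definition disjoint_union :: "ngraph \<Rightarrow> ngraph \<Rightarrow> ngraph" where
  "disjoint_union G H = (let H' = shift_graph (graph_order G) H in
     \<lparr>pverts = pverts G \<union> pverts H', parcs = parcs G \<union> parcs H'\<rparr>)"

definition graph_join :: "ngraph \<Rightarrow> ngraph \<Rightarrow> ngraph" where
  "graph_join G H = (let H' = shift_graph (graph_order G) H in
     \<lparr>pverts = pverts G \<union> pverts H',
      parcs = parcs G \<union> parcs H' \<union> pverts G \<times> pverts H' \<union> pverts H' \<times> pverts G\<rparr>)"

definition H_graph :: "nat \<Rightarrow> nat \<Rightarrow> ngraph" where
  "H_graph n s = graph_join (complete_graph s)
     (disjoint_union (edgeless_graph s) (complete_graph (n - 2 * s)))"

definition L_graph :: "nat \<Rightarrow> nat \<Rightarrow> ngraph" where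
  "L_graph n s = graph_join (complete_graph (s - 1))
     (disjoint_union (edgeless_graph s) (complete_graph (n - 2 * s + 1)))"

definition adjacency_matrix :: "ngraph \<Rightarrow> real mat" where
  "adjacency_matrix G = mat (graph_order G) (graph_order G)
     (\<lambda>(i, j). if (i, j) \<in> parcs G then 1 else 0)"

definition degree_matrix :: "ngraph \<Rightarrow> real mat" where
  "degree_matrix G = mat (graph_order G) (graph_order G)
     (\<lambda>(i, j). if i = j then real (degree_of G i) else 0)"

definition signless_laplacian :: "ngraph \<Rightarrow> real mat" where
  "signless_laplacian G = degree_matrix G + adjacency_matrix G"

text \<open>The matrices are real symmetric, so the largest real eigenvalue is the largest eigenvalue.\<close>

definition graph_rho :: "ngraph \<Rightarrow> real" where
  "graph_rho G = Max (spectrum (adjacency_matrix G))"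

definition graph_q :: "ngraph \<Rightarrow> real" where
  "graph_q G = Max (spectrum (signless_laplacian G))"

definition admissible_graphs :: "nat \<Rightarrow> ngraph \<Rightarrow> nat \<Rightarrow> ngraph set" where
  "admissible_graphs n F k =
     {G \<in> graphs_of_order n. min_degree G \<ge> k \<and> \<not> contains_copy F G}"

definition spex :: "(ngraph \<Rightarrow> real) \<Rightarrow> nat \<Rightarrow> ngraph \<Rightarrow> nat \<Rightarrow> real" where
  "spex lam n F k = Max (lam ` admissible_graphs n F k)"

definition SPEX :: "(ngraph \<Rightarrow> real) \<Rightarrow> nat \<Rightarrow> ngraph \<Rightarrow> nat \<Rightarrow> ngraph set set" where
  "SPEX lam n F k = iso_class ` {G \<in> admissible_graphs n F k. lam G = spex lam n F k}"

end

theory Submission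
  imports Defs "HOL-Analysis.Function_Topology"
begin

text \<open>
  An edge-maximal non-Hamiltonian supergraph of \<open>G\<close> yields, as in Chvatal's theorem, some \<open>a \<ge> k\<close> such
  that the sorted degree sequence of \<open>G\<close> lies below that of \<open>H\<^sub>n\<^sub>,\<^sub>a\<close> (for paths, below that of
  \<open>L\<^sub>n\<^sub>,\<^sub>a\<^sub>+\<^sub>1\<close>). This target is a threshold graph: when vertices are sorted by degree, each one is
  adjacent to an initial segment. Sort the vertices of \<open>G\<close> by the entries of a nonnegative Perron vector
  \<open>x\<close>. Then the number of arcs of \<open>G\<close> between two initial segments is at most that of the threshold
  graph, and summation by parts in both indices gives \<open>x\<^sup>T M(G) x \<le> x\<^sup>T M(H) x\<close>, both for the adjacency
  matrix and for the signless Laplacian. In case of equal largest eigenvalues \<open>x\<close> is also a Perron vector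
  of the connected threshold graph, hence positive, and \<open>M(G) x = M(H) x\<close> then forces \<open>G = H\<close>.
\<close>

subsection \<open>Hamiltonian cycles and paths\<close>

text \<open>The obstacle is that vertices must be sorted by Perron entries, whereas Chvatal's
  condition speaks of degrees, and the two orders may disagree. The condition is therefore kept as
  two counts (vertices of degree at most \<open>a\<close>, vertices of degree below
  \<open>n - s\<close>), which are invariant under relabelling and bound sums of truncated degrees
  over the first \<open>p\<close> vertices in any order. This suffices: for
  \<open>i < p \<le> q\<close>, vertex \<open>i\<close> has at most
  \<open>min (deg E i) (q - 1)\<close> neighbours among the first \<open>q\<close>, since it is not
  its own neighbour, and in the threshold graph every vertex attains the corresponding bound. The
  diagonal of the signless Laplacian contributes only degree sums, which are the case of truncation
  at \<open>n - 1\<close>; hence one parameter \<open>\<theta>\<close> serves both matrices. The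
  number \<open>a\<close> is the smaller degree in a nonadjacent pair of largest degree sum in the
  maximal supergraph, so \<open>k \<le> a\<close> is inherited from the minimum degree. Hamiltonian
  paths are handled as Hamiltonian cycles after adding a vertex joined to all others.\<close>

definition simple_on :: "nat \<Rightarrow> nat rel \<Rightarrow> bool" where
  "simple_on n E \<longleftrightarrow> E \<subseteq> {..<n} \<times> {..<n} \<and> sym E \<and> irrefl E"

definition deg :: "nat rel \<Rightarrow> nat \<Rightarrow> nat" where
  "deg E v = card (E `` {v})"

definition add_edge :: "nat rel \<Rightarrow> nat \<Rightarrow> nat \<Rightarrow> nat rel" where
  "add_edge E u v = E \<union> {(u, v), (v, u)}"

definition ham_cycle :: "nat \<Rightarrow> nat rel \<Rightarrow> (nat \<Rightarrow> nat) \<Rightarrow> bool" where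
  "ham_cycle n E f \<longleftrightarrow> bij_betw f {..<n} {..<n} \<and> (\<forall>i<n. (f i, f (Suc i mod n)) \<in> E)"

definition ham_path :: "nat \<Rightarrow> nat rel \<Rightarrow> (nat \<Rightarrow> nat) \<Rightarrow> bool" where
  "ham_path n E f \<longleftrightarrow> bij_betw f {..<n} {..<n} \<and> (\<forall>i. Suc i < n \<longrightarrow> (f i, f (Suc i)) \<in> E)"

lemma simple_onD:
  assumes "simple_on n E"
  shows "(u, v) \<in> E \<Longrightarrow> u < n" "(u, v) \<in> E \<Longrightarrow> v < n" "(u, v) \<in> E \<Longrightarrow> (v, u) \<in> E"
    "(u, v) \<in> E \<Longrightarrow> u \<noteq> v"
  using assms unfolding simple_on_def by (auto dest: symD simp: irrefl_def)

lemma simple_on_finite: "simple_on n E \<Longrightarrow> finite E"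
  unfolding simple_on_def by (meson finite_SigmaI finite_lessThan finite_subset)

lemma simple_on_add_edge:
  assumes "simple_on n E" "u < n" "v < n" "u \<noteq> v"
  shows "simple_on n (add_edge E u v)"
  using assms unfolding simple_on_def add_edge_def sym_def irrefl_def by auto

lemma bij_betw_rotate:
  fixes n r :: nat
  shows "bij_betw (\<lambda>i. (i + r) mod n) {..<n} {..<n}"
proof -
  have "inj_on (\<lambda>i. (i + r) mod n) {..<n}"
  proof (rule linorder_inj_onI')
    fix i j assume ij: "i \<in> {..<n}" "j \<in> {..<n}" "i < j"
    show "(i + r) mod n \<noteq> (j + r) mod n"
    proof
      assume "(i + r) mod n = (j + r) mod n"
      then have "n dvd (j + r) - (i + r)" using ij mod_eq_dvd_iff_nat[of "i + r" "j + r" n] by simp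
      then show False using ij by (auto dest: dvd_imp_le)
    qed
  qed
  moreover have "(\<lambda>i. (i + r) mod n) ` {..<n} \<subseteq> {..<n}" by auto
  ultimately show ?thesis
    by (simp add: bij_betw_def endo_inj_surj)
qed

text \<open>A cycle has no distinguished start. This allows a chosen edge to be placed across the
  seam from \<open>n - 1\<close> to \<open>0\<close>, or a chosen vertex at a prescribed
  position.\<close>

lemma ham_cycle_rotate:
  assumes "ham_cycle n E f"
  shows "ham_cycle n E (\<lambda>i. f ((i + r) mod n))"
proof -
  have "bij_betw (f \<circ> (\<lambda>i. (i + r) mod n)) {..<n} {..<n}"
    using assms bij_betw_rotate bij_betw_trans unfolding ham_cycle_def by blast
  moreover have "(f ((i + r) mod n), f ((Suc i mod n + r) mod n)) \<in> E" if "i < n" for i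
  proof -
    have "(f ((i + r) mod n), f (Suc ((i + r) mod n) mod n)) \<in> E"
      using assms that unfolding ham_cycle_def by simp
    moreover have "Suc ((i + r) mod n) mod n = (Suc i mod n + r) mod n"
      by (simp add: mod_Suc_eq mod_add_left_eq)
    ultimately show ?thesis by simp
  qed
  ultimately show ?thesis unfolding ham_cycle_def by (simp add: comp_def)
qed

text \<open>The rotation argument of Ore.\<close>

lemma ham_cycle_close_path:
  assumes E: "simple_on n E" and g: "ham_path n E g" and n: "n \<ge> 2"
    and deg: "n \<le> deg E (g 0) + deg E (g (n - 1))"
  shows "\<exists>h. ham_cycle n E h"
proof -
  have bij: "bij_betw g {..<n} {..<n}" and edge: "\<And>i. Suc i < n \<Longrightarrow> (g i, g (Suc i)) \<in> E"
    using g unfolding ham_path_def by auto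
  have inj: "inj_on g {..<n}" and surj: "g ` {..<n} = {..<n}"
    using bij by (auto simp: bij_betw_def)
  \<comment> \<open>Positions \<open>i\<close> where the path edge from \<open>g i\<close> to
    \<open>g (Suc i)\<close> could be cut: \<open>A\<close> offers the chord from the first vertex
    to \<open>g (Suc i)\<close>, \<open>B\<close> the chord from the last vertex to
    \<open>g i\<close>. Both sets live on \<open>n - 1\<close> positions and have at least the two
    end degrees as sizes, so they meet.\<close>
  define A where "A = {i. i < n - 1 \<and> (g 0, g (Suc i)) \<in> E}"
  define B where "B = {i. i < n - 1 \<and> (g (n - 1), g i) \<in> E}"
  have "E `` {g 0} \<subseteq> (\<lambda>i. g (Suc i)) ` A"
  proof
    fix w assume w: "w \<in> E `` {g 0}"
    then have "w \<in> g ` {..<n}" using surj simple_onD[OF E] by auto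
    then obtain j where j: "j < n" "w = g j" by auto
    have "j \<noteq> 0" using w j simple_onD(4)[OF E] by (metis Image_singleton_iff)
    then obtain i where "j = Suc i" by (cases j) auto
    then show "w \<in> (\<lambda>i. g (Suc i)) ` A" using j w by (auto simp: A_def)
  qed
  then have A: "deg E (g 0) \<le> card A"
    unfolding deg_def by (rule surj_card_le[rotated]) (simp add: A_def)
  have "E `` {g (n - 1)} \<subseteq> g ` B"
  proof
    fix w assume w: "w \<in> E `` {g (n - 1)}"
    then have "w \<in> g ` {..<n}" using surj simple_onD[OF E] by auto
    then obtain j where j: "j < n" "w = g j" by auto
    have "j \<noteq> n - 1" using w j simple_onD(4)[OF E] by (metis Image_singleton_iff)
    then show "w \<in> g ` B" using j w by (auto simp: B_def)
  qed
  then have B: "deg E (g (n - 1)) \<le> card B"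
    unfolding deg_def by (rule surj_card_le[rotated]) (simp add: B_def)
  have "A \<union> B \<subseteq> {..<n - 1}" unfolding A_def B_def by auto
  then have "card (A \<union> B) \<le> n - 1"
    by (metis card_lessThan card_mono finite_lessThan)
  moreover have "card A + card B = card (A \<union> B) + card (A \<inter> B)"
    by (rule card_Un_Int) (auto simp: A_def B_def)
  ultimately have "card (A \<inter> B) \<noteq> 0" using A B deg n by linarith
  then obtain i where "i \<in> A \<inter> B" by (metis card.empty ex_in_conv)
  then have i: "i < n - 1" "(g 0, g (Suc i)) \<in> E" "(g (n - 1), g i) \<in> E"
    by (auto simp: A_def B_def)
  \<comment> \<open>Follow the path up to \<open>g i\<close>, jump to its last vertex and run
    backwards to \<open>g (Suc i)\<close>: the index \<open>n + i - j\<close> falls from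
    \<open>n - 1\<close> to \<open>Suc i\<close>. The chord from \<open>g (Suc i)\<close> to
    \<open>g 0\<close> closes the cycle.\<close>
  define p where "p j = (if j \<le> i then j else n + i - j)" for j
  have "inj_on p {..<n}" unfolding p_def by (rule inj_onI) (auto split: if_splits)
  moreover have "p ` {..<n} \<subseteq> {..<n}" unfolding p_def using i by auto
  ultimately have "bij_betw p {..<n} {..<n}"
    by (simp add: bij_betw_def endo_inj_surj)
  then have "bij_betw (g \<circ> p) {..<n} {..<n}" using bij bij_betw_trans by blast
  moreover have "((g \<circ> p) j, (g \<circ> p) (Suc j mod n)) \<in> E" if "j < n" for j
  proof -
    have "j < i \<or> j = i \<or> i < j \<and> Suc j < n \<or> j = n - 1" using that i by auto
    then consider "j < i" | "j = i" | "i < j" "Suc j < n" | "j = n - 1" by blast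
    then show ?thesis
    proof cases
      case 1 then show ?thesis using i edge[of j] by (simp add: p_def)
    next
      case 2 then show ?thesis using i simple_onD(3)[OF E i(3)] by (simp add: p_def)
    next
      case 3
      then have "n + i - j = Suc (n + i - Suc j)" "n + i - j < n" by auto
      then have "(g (n + i - j), g (n + i - Suc j)) \<in> E"
        using edge[of "n + i - Suc j"] simple_onD(3)[OF E] by metis
      then show ?thesis using 3 by (simp add: p_def)
    next
      case 4 then show ?thesis using i simple_onD(3)[OF E i(2)] by (simp add: p_def)
    qed
  qed
  ultimately show ?thesis unfolding ham_cycle_def by blast
qed

text \<open>The closure step of Bondy and Chvatal. A cycle that uses the new edge is rotated until
  this edge lies across the seam; what remains is a Hamiltonian path of \<open>E\<close> with ends
  \<open>u\<close> and \<open>v\<close>, to which \<open>ham_cycle_close_path\<close>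
  applies.\<close>

lemma ham_cycle_add_edge:
  assumes E: "simple_on n E" and n: "n \<ge> 3" and uv: "u < n" "v < n" "u \<noteq> v"
    and f: "ham_cycle n (add_edge E u v) f" and deg: "n \<le> deg E u + deg E v"
  shows "\<exists>h. ham_cycle n E h"
proof (cases "\<forall>i<n. (f i, f (Suc i mod n)) \<in> E")
  case True
  then show ?thesis using f unfolding ham_cycle_def by blast
next
  case False
  then obtain i0 where i0: "i0 < n" "(f i0, f (Suc i0 mod n)) \<notin> E" by blast
  define g where "g = (\<lambda>i. f ((i + Suc i0) mod n))"
  have g: "ham_cycle n (add_edge E u v) g"
    unfolding g_def by (rule ham_cycle_rotate[OF f])
  then have inj: "inj_on g {..<n}" by (auto simp: ham_cycle_def bij_betw_def)
  have "n - 1 + Suc i0 = n + i0" using n by simp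
  then have g_ends: "g (n - 1) = f i0" "g 0 = f (Suc i0 mod n)"
    using i0 unfolding g_def by (auto simp del: add_Suc_right)
  have "(f i0, f (Suc i0 mod n)) \<in> add_edge E u v"
    using f i0 unfolding ham_cycle_def by blast
  then have ends: "{g (n - 1), g 0} = {u, v}"
    using i0 unfolding g_ends add_edge_def by auto
  have "(g i, g (Suc i)) \<in> E" if i: "Suc i < n" for i
  proof (rule ccontr)
    assume "(g i, g (Suc i)) \<notin> E"
    moreover have "(g i, g (Suc i)) \<in> add_edge E u v"
      using g i unfolding ham_cycle_def by (metis Suc_lessD mod_less)
    ultimately have "{g i, g (Suc i)} = {g (n - 1), g 0}"
      using ends unfolding add_edge_def by auto
    \<comment> \<open>A second passage through the new edge would have the same two ends as the
      seam. Injectivity carries this over to positions, where \<open>n \<ge> 3\<close> separates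
      consecutive positions from the seam.\<close>
    then have "g ` {i, Suc i} = g ` {n - 1, 0}" by simp
    then have "{i, Suc i} = {n - 1, 0}"
      using inj_on_image_eq_iff[OF inj, of "{i, Suc i}" "{n - 1, 0}"] i n by auto
    then show False using n by (auto simp: doubleton_eq_iff)
  qed
  then have "ham_path n E g" using g unfolding ham_path_def ham_cycle_def by blast
  moreover have "deg E (g 0) + deg E (g (n - 1)) = deg E u + deg E v"
    using ends by (auto simp: doubleton_eq_iff)
  ultimately show ?thesis using ham_cycle_close_path[OF E] n deg by auto
qed

section \<open>Paths as cycles through an added vertex\<close>

text \<open>The join with one new vertex, labelled \<open>n\<close>. Deleting that vertex from a
  Hamiltonian cycle leaves a Hamiltonian path of \<open>E\<close>, and conversely a path is closed
  up through it.\<close>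

definition hub :: "nat \<Rightarrow> nat rel \<Rightarrow> nat rel" where
  "hub n E = E \<union> {n} \<times> {..<n} \<union> {..<n} \<times> {n}"

lemma simple_on_hub:
  assumes "simple_on n E"
  shows "simple_on (Suc n) (hub n E)"
  using assms unfolding simple_on_def hub_def sym_def irrefl_def by auto

lemma deg_hub:
  assumes "simple_on n E" "v < n"
  shows "deg (hub n E) v = Suc (deg E v)"
proof -
  have "hub n E `` {v} = insert n (E `` {v})" using assms(2) unfolding hub_def by auto
  moreover have "n \<notin> E `` {v}" using simple_onD(2)[OF assms(1)] by auto
  moreover have "finite (E `` {v})" using simple_on_finite[OF assms(1)] by (rule finite_Image)
  ultimately show ?thesis unfolding deg_def by simp
qed

lemma ham_cycle_hub_if_ham_path:
  assumes f: "ham_path n E f" and n: "n \<ge> 1"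
  shows "\<exists>g. ham_cycle (Suc n) (hub n E) g"
proof -
  define g where "g = f(n := n)"
  have bij: "bij_betw f {..<n} {..<n}" and edge: "\<And>i. Suc i < n \<Longrightarrow> (f i, f (Suc i)) \<in> E"
    using f unfolding ham_path_def by auto
  have lt: "f i < n" if "i < n" for i using bij that by (auto simp: bij_betw_def)
  have "bij_betw g {..<n} {..<n}" using bij unfolding g_def by (rule bij_betw_cong[THEN iffD1, rotated]) auto
  then have "bij_betw g ({..<n} \<union> {n}) ({..<n} \<union> {n})"
    by (rule bij_betw_combine) (auto simp: g_def bij_betw_def)
  then have "bij_betw g {..<Suc n} {..<Suc n}" by (simp add: lessThan_Suc Un_commute)
  moreover have "(g i, g (Suc i mod Suc n)) \<in> hub n E" if "i < Suc n" for i
  proof -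
    have "Suc i < n \<or> Suc i = n \<or> i = n" using that by auto
    then consider "Suc i < n" | "Suc i = n" | "i = n" by blast
    then show ?thesis
      by cases (use edge lt n in \<open>auto simp: g_def hub_def\<close>)
  qed
  ultimately show ?thesis unfolding ham_cycle_def by blast
qed

lemma ham_path_if_ham_cycle_hub:
  assumes f: "ham_cycle (Suc n) (hub n E) f"
  shows "\<exists>g. ham_path n E g"
proof -
  have "n \<in> f ` {..<Suc n}" using f unfolding ham_cycle_def bij_betw_def by simp
  then obtain i0 where i0: "i0 < Suc n" "f i0 = n" by auto
  \<comment> \<open>The shift by \<open>Suc i0\<close> brings the new vertex to the last position
    \<open>n\<close>, so positions below \<open>n\<close> enumerate the path.\<close>
  define g where "g = (\<lambda>i. f ((i + Suc i0) mod Suc n))"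
  have g: "ham_cycle (Suc n) (hub n E) g"
    unfolding g_def by (rule ham_cycle_rotate[OF f])
  have "n + Suc i0 = Suc n + i0" by simp
  then have gn: "g n = n" using i0 unfolding g_def by (metis mod_add_self1 mod_less)
  have bij: "bij_betw g {..<Suc n} {..<Suc n}" using g unfolding ham_cycle_def by blast
  then have "bij_betw g ({..<Suc n} - {n}) ({..<Suc n} - {g n})"
    by (rule bij_betw_DiffI) (auto simp: gn bij_betw_def)
  then have bij': "bij_betw g {..<n} {..<n}" unfolding gn by (simp add: lessThan_Suc)
  have "(g i, g (Suc i)) \<in> E" if i: "Suc i < n" for i
  proof -
    have "(g i, g (Suc i)) \<in> hub n E"
      using g i unfolding ham_cycle_def by (metis Suc_lessD Suc_mono less_Suc_eq mod_less)
    moreover have "g i < n" "g (Suc i) < n" using bij' i by (auto simp: bij_betw_def)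
    ultimately show ?thesis unfolding hub_def by auto
  qed
  then show ?thesis using bij' unfolding ham_path_def by blast
qed

text \<open>The cycle version is applied to the hub. Passing to it raises the order by one and the
  degree sum by two, whence the bound \<open>n - 1\<close> in place of \<open>n\<close>.\<close>

lemma ham_path_add_edge:
  assumes E: "simple_on n E" and n: "n \<ge> 2" and uv: "u < n" "v < n" "u \<noteq> v"
    and f: "ham_path n (add_edge E u v) f" and deg: "n - 1 \<le> deg E u + deg E v"
  shows "\<exists>h. ham_path n E h"
proof -
  have "hub n (add_edge E u v) = add_edge (hub n E) u v" unfolding hub_def add_edge_def by auto
  then obtain g where "ham_cycle (Suc n) (add_edge (hub n E) u v) g"
    using ham_cycle_hub_if_ham_path[OF f] n by auto
  moreover have "Suc n \<le> deg (hub n E) u + deg (hub n E) v"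
    using deg uv by (simp add: deg_hub[OF E])
  ultimately have "\<exists>h. ham_cycle (Suc n) (hub n E) h"
    using ham_cycle_add_edge[OF simple_on_hub[OF E], of u v g] \<open>ham_cycle _ _ g\<close> n uv by simp
  then show ?thesis using ham_path_if_ham_cycle_hub by blast
qed

text \<open>A Hamiltonian cycle would alternate between \<open>S\<close> and \<open>R\<close> and never leave their union.\<close>

lemma no_ham_cycle_if_independent:
  assumes sym: "sym E" and SR: "S \<subseteq> {..<n}" "R \<subseteq> {..<n}" "S \<union> R \<noteq> {..<n}"
    and S: "S \<noteq> {}" and card: "card R \<le> card S" and nb: "\<And>u v. (u, v) \<in> E \<Longrightarrow> u \<in> S \<Longrightarrow> v \<in> R"
  shows "\<not> ham_cycle n E f"
proof
  assume f0: "ham_cycle n E f"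
  obtain v where v: "v \<in> S" using S by blast
  then have "v \<in> f ` {..<n}" using f0 SR unfolding ham_cycle_def bij_betw_def by auto
  then obtain r where r: "r < n" "f r = v" by auto
  define g where "g = (\<lambda>i. f ((i + r) mod n))"
  have g: "ham_cycle n E g" unfolding g_def by (rule ham_cycle_rotate[OF f0])
  have g0: "g 0 \<in> S" using r v unfolding g_def by simp
  have bij: "bij_betw g {..<n} {..<n}" and edge: "\<And>i. i < n \<Longrightarrow> (g i, g (Suc i mod n)) \<in> E"
    using g unfolding ham_cycle_def by auto
  have pos: "card {i. i < n \<and> g i \<in> X} = card X" if "X \<subseteq> {..<n}" for X
  proof -
    have "X \<subseteq> g ` {i. i < n \<and> g i \<in> X}"
    proof
      fix y assume y: "y \<in> X"
      then have "y \<in> g ` {..<n}" using that bij unfolding bij_betw_def by auto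
      then show "y \<in> g ` {i. i < n \<and> g i \<in> X}" using y by auto
    qed
    moreover have "inj_on g {i. i < n \<and> g i \<in> X}"
      by (rule inj_on_subset[of g "{..<n}"]) (use bij in \<open>auto simp: bij_betw_def\<close>)
    ultimately have "bij_betw g {i. i < n \<and> g i \<in> X} X" by (auto simp: bij_betw_def)
    then show ?thesis by (rule bij_betw_same_card)
  qed
  define I J where "I = {i. i < n \<and> g i \<in> S}" and "J = {i. i < n \<and> g i \<in> R}"
  \<comment> \<open>Positions whose successor lies in \<open>S\<close>. They are as many as the
    elements of \<open>S\<close>, and by symmetry of \<open>E\<close> they all belong to
    \<open>J\<close>, which is no larger. So \<open>P = J\<close>: each vertex of \<open>R\<close>
    is followed by one of \<open>S\<close>, just as each vertex of \<open>S\<close> is followed by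
    one of \<open>R\<close>.\<close>
  define P where "P = {i. i < n \<and> g (Suc i mod n) \<in> S}"
  have "bij_betw (\<lambda>i. Suc i mod n) {..<n} {..<n}" using bij_betw_rotate[of 1 n] by simp
  then have rot: "inj_on (\<lambda>i. Suc i mod n) {..<n}" "(\<lambda>i. Suc i mod n) ` {..<n} = {..<n}"
    by (auto simp: bij_betw_def)
  have "I \<subseteq> (\<lambda>i. Suc i mod n) ` P"
  proof
    fix j assume j: "j \<in> I"
    then have "j \<in> (\<lambda>i. Suc i mod n) ` {..<n}" using rot(2) by (simp add: I_def)
    then show "j \<in> (\<lambda>i. Suc i mod n) ` P" using j by (auto simp: I_def P_def)
  qed
  moreover have "inj_on (\<lambda>i. Suc i mod n) P"
    using rot(1) by (rule inj_on_subset) (auto simp: P_def)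
  ultimately have "bij_betw (\<lambda>i. Suc i mod n) P I"
    by (auto simp: bij_betw_def P_def I_def)
  then have "card P = card I" by (rule bij_betw_same_card)
  moreover have "P \<subseteq> J"
    unfolding P_def J_def using edge nb sym by (auto dest: symD)
  moreover have "card J \<le> card I" unfolding I_def J_def using pos SR card by simp
  moreover have "finite J" unfolding J_def by simp
  ultimately have PJ: "P = J" by (simp add: card_seteq)
  have "g i \<in> S \<union> R" if "i < n" for i
    using that
  proof (induction i)
    case 0 then show ?case using g0 by simp
  next
    case (Suc i)
    then have mod: "Suc i mod n = Suc i" by simp
    from Suc consider "g i \<in> S" | "i \<in> J" by (auto simp: J_def)
    then show ?case
    proof cases
      case 1 then show ?thesis using nb edge[of i] Suc.prems mod by force
    next
      case 2 then have "i \<in> P" using PJ by simp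
      then show ?thesis using mod by (simp add: P_def)
    qed
  qed
  then have "g ` {..<n} \<subseteq> S \<union> R" by auto
  then show False using bij SR by (auto simp: bij_betw_def)
qed

text \<open>Chvatal's degree condition, read off an edge-maximal supergraph; take \<open>t = 0\<close> for cycles and \<open>t = 1\<close> for paths.\<close>

lemma chvatal_degrees:
  assumes E0: "simple_on n E0" "P E0" and deg0: "\<And>v. v < n \<Longrightarrow> k \<le> deg E0 v"
    and compl: "\<not> P {(i, j). i < n \<and> j < n \<and> i \<noteq> j}"
    and closed: "\<And>E u v. simple_on n E \<Longrightarrow> P E \<Longrightarrow> u < n \<Longrightarrow> v < n \<Longrightarrow> u \<noteq> v \<Longrightarrow> (u, v) \<notin> E \<Longrightarrow>
      n - t \<le> deg E u + deg E v \<Longrightarrow> P (add_edge E u v)"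
  shows "\<exists>a\<ge>k. 2 * a + t < n \<and> a + t \<le> card {w. w < n \<and> deg E0 w \<le> a}
    \<and> n - a \<le> card {w. w < n \<and> deg E0 w < n - (a + t)}"
proof -
  define C where "C = {E. simple_on n E \<and> P E \<and> E0 \<subseteq> E}"
  have "C \<subseteq> Pow ({..<n} \<times> {..<n})" unfolding C_def simple_on_def by auto
  then have "finite C" by (rule finite_subset) auto
  moreover have "E0 \<in> C" using E0 unfolding C_def by simp
  ultimately have "\<exists>E\<in>C. E0 \<subseteq> E \<and> (\<forall>E'\<in>C. E \<subseteq> E' \<longrightarrow> E = E')"
    by (rule finite_has_maximal2)
  then obtain E where E: "E \<in> C" and maximal: "\<forall>E'\<in>C. E \<subseteq> E' \<longrightarrow> E = E'" by (elim bexE conjE)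
  then have sE: "simple_on n E" and PE: "P E" and sub: "E0 \<subseteq> E" by (auto simp: C_def)
  have low: "deg E u + deg E v < n - t"
    if "u < n" "v < n" "u \<noteq> v" "(u, v) \<notin> E" for u v
  proof (rule ccontr)
    assume "\<not> ?thesis"
    then have "P (add_edge E u v)" using closed[OF sE PE that] by simp
    then have "add_edge E u v \<in> C"
      using simple_on_add_edge[OF sE] that sub unfolding C_def add_edge_def by auto
    moreover have "E \<subseteq> add_edge E u v" unfolding add_edge_def by blast
    ultimately have "E = add_edge E u v" using maximal by simp
    then show False using that(4) unfolding add_edge_def by blast
  qed
  \<comment> \<open>Both directions are used: upper bounds on degrees descend from \<open>E\<close>
    to \<open>E0\<close>, and the lower bound \<open>k\<close> ascends from \<open>E0\<close> to
    \<open>E\<close>.\<close>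
  have degE: "deg E0 w \<le> deg E w" for w
    unfolding deg_def using sub by (intro card_mono finite_Image simple_on_finite[OF sE]) auto
  define N where "N = {(u, v). u < n \<and> v < n \<and> u \<noteq> v \<and> (u, v) \<notin> E}"
  have Nfin: "finite N" unfolding N_def by (rule finite_subset[of _ "{..<n} \<times> {..<n}"]) auto
  have "N \<noteq> {}"
  proof
    assume "N = {}"
    then have "E = {(i, j). i < n \<and> j < n \<and> i \<noteq> j}"
      unfolding N_def by (auto dest: simple_onD(1,2,4)[OF sE])
    then show False using compl PE by blast
  qed
  define m where "m = Max ((\<lambda>q. deg E (fst q) + deg E (snd q)) ` N)"
  have "m \<in> (\<lambda>q. deg E (fst q) + deg E (snd q)) ` N"
    unfolding m_def using Nfin \<open>N \<noteq> {}\<close> by (intro Max_in) auto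
  then obtain p where "p \<in> N" "deg E (fst p) + deg E (snd p) = m" by auto
  then have p: "p \<in> N" "\<And>q. q \<in> N \<Longrightarrow> deg E (fst q) + deg E (snd q) \<le> deg E (fst p) + deg E (snd p)"
    using Max_ge[of "(\<lambda>q. deg E (fst q) + deg E (snd q)) ` N"] Nfin unfolding m_def by auto
  \<comment> \<open>The extremal choice behind both counts: a nonadjacent pair of largest degree
    sum, ordered so that \<open>deg E u\<close>, the future \<open>a\<close>, is the smaller
    degree.\<close>
  obtain u v where uv: "(u, v) \<in> N" "deg E u \<le> deg E v"
    and max: "\<And>x y. (x, y) \<in> N \<Longrightarrow> deg E x + deg E y \<le> deg E u + deg E v"
  proof (cases "deg E (fst p) \<le> deg E (snd p)")
    case True
    then show thesis using that[of "fst p" "snd p"] p by force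
  next
    case False
    moreover have "(snd p, fst p) \<in> N" using p(1) simple_onD(3)[OF sE] unfolding N_def by auto
    ultimately show thesis using that[of "snd p" "fst p"] p by force
  qed
  have uvn: "u < n" "v < n" "u \<noteq> v" "(u, v) \<notin> E" "(v, u) \<notin> E"
    using uv(1) simple_onD(3)[OF sE] unfolding N_def by auto
  have sum: "deg E u + deg E v < n - t" using low[OF uvn(1-4)] .
  have nonnb: "card {w. w < n \<and> (x, w) \<notin> E} = n - deg E x" for x
  proof -
    have "{w. w < n \<and> (x, w) \<notin> E} = {..<n} - E `` {x}" by auto
    moreover have "E `` {x} \<subseteq> {..<n}" using simple_onD(2)[OF sE] by auto
    ultimately show ?thesis unfolding deg_def by (simp add: card_Diff_subset finite_subset)
  qed
  have finS: "finite {w. w < n \<and> Q w}" for Q by simp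
  \<comment> \<open>Any \<open>w\<close> other than \<open>v\<close> that is not adjacent to
    \<open>v\<close> competes with \<open>u\<close> as its partner, so its degree is at most that of
    \<open>u\<close>. There are \<open>n - deg E v - 1\<close> such \<open>w\<close>, and this is at
    least \<open>deg E u + t\<close> by \<open>sum\<close>.\<close>
  have 1: "deg E u + t \<le> card {w. w < n \<and> deg E0 w \<le> deg E u}"
  proof -
    have "{w. w < n \<and> (v, w) \<notin> E} - {v} \<subseteq> {w. w < n \<and> deg E0 w \<le> deg E u}"
    proof
      fix w assume w: "w \<in> {w. w < n \<and> (v, w) \<notin> E} - {v}"
      then have "(w, v) \<notin> E" using simple_onD(3)[OF sE, of w v] by auto
      then have "(w, v) \<in> N" using uvn w unfolding N_def by auto
      then have "deg E w \<le> deg E u" using max by fastforce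
      then show "w \<in> {w. w < n \<and> deg E0 w \<le> deg E u}" using degE[of w] w by auto
    qed
    then have "card ({w. w < n \<and> (v, w) \<notin> E} - {v}) \<le> card {w. w < n \<and> deg E0 w \<le> deg E u}"
      by (intro card_mono finS)
    moreover have "card ({w. w < n \<and> (v, w) \<notin> E} - {v}) = n - deg E v - 1"
      using nonnb[of v] uvn simple_onD(4)[OF sE, of v v] by (subst card_Diff_singleton) auto
    ultimately show ?thesis using sum by linarith
  qed
  \<comment> \<open>The same exchange at \<open>u\<close> bounds degrees by \<open>deg E v\<close>.
    Here \<open>u\<close> itself may be counted, because
    \<open>deg E u \<le> deg E v\<close>.\<close>
  have 2: "n - deg E u \<le> card {w. w < n \<and> deg E0 w < n - (deg E u + t)}"
  proof -
    have "{w. w < n \<and> (u, w) \<notin> E} \<subseteq> {w. w < n \<and> deg E0 w < n - (deg E u + t)}"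
    proof
      fix w assume w: "w \<in> {w. w < n \<and> (u, w) \<notin> E}"
      then have "w = u \<or> (u, w) \<in> N" using uvn unfolding N_def by auto
      then have "deg E w \<le> deg E v" using max[of u w] uv(2) by auto
      then show "w \<in> {w. w < n \<and> deg E0 w < n - (deg E u + t)}" using degE[of w] w sum by auto
    qed
    then have "card {w. w < n \<and> (u, w) \<notin> E} \<le> card {w. w < n \<and> deg E0 w < n - (deg E u + t)}"
      by (intro card_mono finS)
    then show ?thesis using nonnb[of u] by simp
  qed
  have "k \<le> deg E u" using deg0[OF uvn(1)] degE[of u] by linarith
  then show ?thesis using 1 2 sum uv(2) by (intro exI[of _ "deg E u"]) auto
qed

subsection \<open>Quadratic forms and the largest eigenvalue\<close>

text \<open>Matrices and vectors are index functions of which only the values below \<open>n\<close>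
  are read. Prefix sums and relabellings thus become manipulations of finite sums;
  \<open>eigenvalue_iff_mv\<close> is the bridge to the matrix spectrum.\<close>

definition mv :: "nat \<Rightarrow> (nat \<Rightarrow> nat \<Rightarrow> real) \<Rightarrow> (nat \<Rightarrow> real) \<Rightarrow> nat \<Rightarrow> real" where
  "mv n M x i = (\<Sum>j<n. M i j * x j)"

definition bil :: "nat \<Rightarrow> (nat \<Rightarrow> nat \<Rightarrow> real) \<Rightarrow> (nat \<Rightarrow> real) \<Rightarrow> (nat \<Rightarrow> real) \<Rightarrow> real" where
  "bil n M x y = (\<Sum>i<n. x i * mv n M y i)"

definition top_eigenvalue :: "nat \<Rightarrow> (nat \<Rightarrow> nat \<Rightarrow> real) \<Rightarrow> real" where
  "top_eigenvalue n M = Max (spectrum (Matrix.mat n n (\<lambda>(i, j). M i j)))"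

lemma mv_add_scale: "mv n M (\<lambda>i. x i + t * y i) i = mv n M x i + t * mv n M y i"
  unfolding mv_def by (simp add: algebra_simps sum.distrib sum_distrib_left)

lemma bil_commute:
  assumes "\<And>i j. i < n \<Longrightarrow> j < n \<Longrightarrow> M i j = M j i"
  shows "bil n M x y = bil n M y x"
proof -
  have "bil n M x y = (\<Sum>j<n. \<Sum>i<n. x i * (M i j * y j))"
    unfolding bil_def mv_def sum_distrib_left by (rule sum.swap)
  also have "\<dots> = (\<Sum>j<n. \<Sum>i<n. y j * (M j i * x i))"
    using assms by (intro sum.cong) auto
  finally show ?thesis unfolding bil_def mv_def sum_distrib_left .
qed

lemma eigenvalue_iff_mv:
  "eigenvalue (Matrix.mat n n (\<lambda>(i, j). M i j)) k \<longleftrightarrow>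
    (\<exists>x. (\<exists>i<n. x i \<noteq> 0) \<and> (\<forall>i<n. mv n M x i = k * x i))"
    (is "eigenvalue ?A k \<longleftrightarrow> _")
proof -
  have mult: "(?A *\<^sub>v Matrix.vec n x) $ i = mv n M x i" if "i < n" for x i
    using that unfolding mv_def by (simp add: scalar_prod_def lessThan_atLeast0)
  show ?thesis
  proof
    assume "eigenvalue ?A k"
    then obtain v where v: "v \<in> carrier_vec n" "v \<noteq> 0\<^sub>v n" "?A *\<^sub>v v = k \<cdot>\<^sub>v v"
      unfolding eigenvalue_def eigenvector_def by auto
    have vec: "Matrix.vec n (\<lambda>i. v $ i) = v" using v(1) by auto
    have "\<exists>i<n. v $ i \<noteq> 0" using v(1,2) by (metis carrier_vecD dim_vec eq_vecI index_zero_vec(1,2))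
    moreover have "mv n M (\<lambda>i. v $ i) i = k * v $ i" if "i < n" for i
      using mult[OF that, of "\<lambda>i. v $ i"] v(1,3) that unfolding vec by simp
    ultimately show "\<exists>x. (\<exists>i<n. x i \<noteq> 0) \<and> (\<forall>i<n. mv n M x i = k * x i)" by blast
  next
    assume "\<exists>x. (\<exists>i<n. x i \<noteq> 0) \<and> (\<forall>i<n. mv n M x i = k * x i)"
    then obtain x where x: "\<exists>i<n. x i \<noteq> 0" "\<forall>i<n. mv n M x i = k * x i" by blast
    have "Matrix.vec n x \<noteq> 0\<^sub>v n" using x(1) by (metis index_vec index_zero_vec(1))
    moreover have "?A *\<^sub>v Matrix.vec n x = k \<cdot>\<^sub>v Matrix.vec n x"
      by (rule eq_vecI) (use mult x(2) in auto)
    ultimately show "eigenvalue ?A k"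
      unfolding eigenvalue_def eigenvector_def by (intro exI[of _ "Matrix.vec n x"]) auto
  qed
qed

text \<open>The nonnegative part of the unit sphere is compact, so the form attains a maximum there.
  With nonnegative entries in \<open>M\<close>, replacing \<open>y\<close> by its absolute value
  does not decrease the form, so this maximum also bounds vectors of arbitrary sign.\<close>

lemma rayleigh_maximizer_nonneg:
  assumes n: "n \<ge> 1" and M: "\<And>i j. i < n \<Longrightarrow> j < n \<Longrightarrow> 0 \<le> M i j"
  shows "\<exists>x. (\<forall>i. 0 \<le> x i) \<and> (\<Sum>i<n. (x i)\<^sup>2) = 1 \<and>
    (\<forall>y. bil n M y y \<le> bil n M x x * (\<Sum>i<n. (y i)\<^sup>2))"
proof -
  \<comment> \<open>The vectors are functions on all of \<open>nat\<close>; pinning the coordinates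
    from \<open>n\<close> on to 0 makes every factor of the product compact.\<close>
  define S :: "nat \<Rightarrow> real set" where "S i = (if i < n then {0..1} else {0})" for i
  define K where "K = PiE UNIV S \<inter> {x. (\<Sum>i<n. (x i)\<^sup>2) = 1}"
  have "compactin (product_topology (\<lambda>i. euclidean) UNIV) (PiE UNIV S)"
    unfolding compactin_PiE S_def by auto
  then have "compact (PiE UNIV S)" by (simp add: euclidean_product_topology)
  moreover have "closed {x :: nat \<Rightarrow> real. (\<Sum>i<n. (x i)\<^sup>2) = 1}"
    by (intro closed_Collect_eq continuous_intros continuous_on_product_coordinates)
  ultimately have "compact K" unfolding K_def by (rule compact_Int_closed)
  have K: "(\<lambda>i. if i < n then x i else 0) \<in> K"
    if "\<And>i. i < n \<Longrightarrow> 0 \<le> x i" "(\<Sum>i<n. (x i)\<^sup>2) = 1" for x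
  proof -
    have "x i \<le> 1" if i: "i < n" for i
    proof -
      have "(x i)\<^sup>2 \<le> (\<Sum>i<n. (x i)\<^sup>2)" using i by (intro member_le_sum) auto
      then show ?thesis using \<open>(\<Sum>i<n. (x i)\<^sup>2) = 1\<close> by (simp add: abs_square_le_1)
    qed
    then show ?thesis using that unfolding K_def S_def by auto
  qed
  have bil_cut: "bil n M (\<lambda>i. if i < n then x i else 0) (\<lambda>i. if i < n then x i else 0) = bil n M x x" for x
    unfolding bil_def mv_def by (intro sum.cong arg_cong2[of _ _ _ _ "(*)"]) auto
  have "(\<Sum>i<n. (if i = 0 then 1 else 0 :: real)\<^sup>2) = (\<Sum>i<n. if i = 0 then 1 else 0)"
    by (intro sum.cong) auto
  then have "(\<lambda>i. if i < n then (if i = 0 then 1 else 0) else 0) \<in> K"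
    using n by (intro K) (auto simp: sum.delta)
  then have "K \<noteq> {}" by blast
  moreover have "continuous_on K (\<lambda>x. bil n M x x)"
    unfolding bil_def mv_def
    by (intro continuous_intros continuous_on_subset[OF continuous_on_product_coordinates]) auto
  ultimately obtain x where x: "x \<in> K" "\<And>z. z \<in> K \<Longrightarrow> bil n M z z \<le> bil n M x x"
    using continuous_attains_sup[OF \<open>compact K\<close>] by blast
  have "bil n M y y \<le> bil n M x x * (\<Sum>i<n. (y i)\<^sup>2)" for y
  proof (cases "(\<Sum>i<n. (y i)\<^sup>2) = 0")
    case True
    then have "\<forall>i<n. y i = 0" by (simp add: sum_nonneg_eq_0_iff)
    then have "bil n M y y = 0" unfolding bil_def by simp
    then show ?thesis using True by simp
  next
    case False
    define c where "c = sqrt (\<Sum>i<n. (y i)\<^sup>2)"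
    have "(\<Sum>i<n. (y i)\<^sup>2) > 0" using False sum_nonneg[of "{..<n}" "\<lambda>i. (y i)\<^sup>2"] by simp
    then have c: "c > 0" "c\<^sup>2 = (\<Sum>i<n. (y i)\<^sup>2)" unfolding c_def by auto
    define z where "z i = \<bar>y i\<bar> / c" for i
    have "(\<Sum>i<n. (z i)\<^sup>2) = 1"
      using c(1) by (simp add: z_def power_divide flip: sum_divide_distrib c(2))
    moreover have "0 \<le> z i" for i using c(1) by (simp add: z_def)
    ultimately have "bil n M z z \<le> bil n M x x"
      using x(2)[OF K[of z]] unfolding bil_cut by simp
    have "bil n M y y \<le> c\<^sup>2 * bil n M z z"
    proof -
      have "bil n M y y \<le> (\<Sum>i<n. \<Sum>j<n. \<bar>y i\<bar> * (M i j * \<bar>y j\<bar>))"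
        unfolding bil_def mv_def sum_distrib_left
      proof (intro sum_mono)
        fix i j assume "i \<in> {..<n}" "j \<in> {..<n}"
        then have "\<bar>y i * (M i j * y j)\<bar> = \<bar>y i\<bar> * (M i j * \<bar>y j\<bar>)" using M by (simp add: abs_mult)
        then show "y i * (M i j * y j) \<le> \<bar>y i\<bar> * (M i j * \<bar>y j\<bar>)" by linarith
      qed
      also have "\<dots> = c\<^sup>2 * bil n M z z"
        unfolding bil_def mv_def sum_distrib_left using c
        by (intro sum.cong) (auto simp: z_def power2_eq_square)
      finally show ?thesis .
    qed
    then have "bil n M y y \<le> c\<^sup>2 * bil n M x x"
      using mult_left_mono[OF \<open>bil n M z z \<le> bil n M x x\<close>, of "c\<^sup>2"] by simp
    then show ?thesis using c(2) by (simp add: mult.commute)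
  qed
  then show ?thesis using x(1) unfolding K_def S_def by (intro exI[of _ x]) (auto simp: PiE_iff split: if_splits)
qed

text \<open>First-order condition: moving from \<open>x\<close> along the residual \<open>r\<close>
  gains \<open>2 * t * c\<close> to first order in the difference of the two sides of
  \<open>max\<close>, where \<open>c\<close> is the squared norm of \<open>r\<close>, so
  \<open>c\<close> must vanish. Stated for every \<open>x\<close> attaining a bound
  \<open>k\<close>, because it also serves to carry an eigenvector from one graph over to
  another.\<close>

lemma rayleigh_attained_imp_eigen:
  assumes sym: "\<And>i j. i < n \<Longrightarrow> j < n \<Longrightarrow> M i j = M j i"
    and max: "\<And>y. bil n M y y \<le> k * (\<Sum>i<n. (y i)\<^sup>2)"
    and att: "bil n M x x = k * (\<Sum>i<n. (x i)\<^sup>2)" and i: "i < n"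
  shows "mv n M x i = k * x i"
proof -
  define r where "r j = mv n M x j - k * x j" for j
  define b where "b = k * (\<Sum>j<n. (r j)\<^sup>2) - bil n M r r"
  define c where "c = (\<Sum>j<n. (r j)\<^sup>2)"
  have ineq: "2 * t * c \<le> t\<^sup>2 * b" for t
  proof -
    have "bil n M (\<lambda>i. x i + t * r i) (\<lambda>i. x i + t * r i)
        = bil n M x x + t * bil n M x r + t * bil n M r x + t\<^sup>2 * bil n M r r"
      unfolding bil_def mv_add_scale
      by (simp add: algebra_simps sum.distrib sum_distrib_left power2_eq_square)
    also have "\<dots> = bil n M x x + 2 * t * bil n M r x + t\<^sup>2 * bil n M r r"
      using bil_commute[where x = x and y = r, OF sym] by (simp add: algebra_simps)
    also have "bil n M r x = c + k * (\<Sum>j<n. r j * x j)"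
    proof -
      have "bil n M r x = (\<Sum>j<n. (r j)\<^sup>2 + k * (r j * x j))"
        unfolding bil_def by (intro sum.cong) (auto simp: r_def power2_eq_square algebra_simps)
      then show ?thesis unfolding c_def by (simp add: sum.distrib sum_distrib_left)
    qed
    finally have "bil n M (\<lambda>i. x i + t * r i) (\<lambda>i. x i + t * r i)
      = bil n M x x + 2 * t * (c + k * (\<Sum>j<n. r j * x j)) + t\<^sup>2 * bil n M r r" .
    moreover have "(\<Sum>i<n. (x i + t * r i)\<^sup>2) = (\<Sum>i<n. (x i)\<^sup>2) + 2 * t * (\<Sum>j<n. r j * x j) + t\<^sup>2 * c"
      unfolding c_def by (simp add: power2_sum power_mult_distrib sum.distrib sum_distrib_left algebra_simps)
    ultimately show ?thesis
      using max[of "\<lambda>i. x i + t * r i"] att unfolding b_def c_def[symmetric] by (simp add: algebra_simps)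
  qed
  have c0: "c \<ge> 0" unfolding c_def by (rule sum_nonneg) simp
  have "c \<le> 0"
  proof (rule ccontr)
    assume "\<not> c \<le> 0"
    then have c: "c > 0" by simp
    \<comment> \<open>Small enough that \<open>t * b \<le> c\<close>; then
      \<open>t\<^sup>2 * b \<le> t * c < 2 * t * c\<close>, against \<open>ineq\<close>.\<close>
    define t where "t = c / (1 + \<bar>b\<bar>)"
    have t: "t > 0" using c unfolding t_def by simp
    have "t * b \<le> t * (1 + \<bar>b\<bar>)" using t by (intro mult_left_mono) auto
    also have "\<dots> = c" unfolding t_def by simp
    finally have "t * (t * b) \<le> t * c" using t by (intro mult_left_mono) auto
    moreover have "t * c > 0" using t c by simp
    ultimately show False using ineq[of t] by (simp add: power2_eq_square)
  qed
  then have "c = 0" using c0 by simp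
  then have "r i = 0" using i unfolding c_def by (simp add: sum_nonneg_eq_0_iff)
  then show ?thesis unfolding r_def by simp
qed

lemma bil_eigen:
  assumes "\<And>i. i < n \<Longrightarrow> mv n M x i = k * x i"
  shows "bil n M x x = k * (\<Sum>i<n. (x i)\<^sup>2)"
  unfolding bil_def sum_distrib_left using assms by (intro sum.cong) (auto simp: power2_eq_square)

text \<open>The maximizer of the form is an eigenvector for the maximal value, and every eigenvalue
  is the Rayleigh quotient of its eigenvector. Hence the maximum of the spectrum is the maximum of
  the form on the unit sphere.\<close>

lemma top_eigenvalue_nonneg_sym:
  assumes n: "n \<ge> 1" and M: "\<And>i j. i < n \<Longrightarrow> j < n \<Longrightarrow> 0 \<le> M i j"
    and sym: "\<And>i j. i < n \<Longrightarrow> j < n \<Longrightarrow> M i j = M j i"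
  obtains x where "\<And>i. 0 \<le> x i" "(\<Sum>i<n. (x i)\<^sup>2) = 1"
    "\<And>i. i < n \<Longrightarrow> mv n M x i = top_eigenvalue n M * x i"
    "\<And>y. bil n M y y \<le> top_eigenvalue n M * (\<Sum>i<n. (y i)\<^sup>2)"
proof -
  let ?A = "Matrix.mat n n (\<lambda>(i, j). M i j)"
  obtain x where x: "\<And>i. 0 \<le> x i" "(\<Sum>i<n. (x i)\<^sup>2) = 1"
    "\<And>y. bil n M y y \<le> bil n M x x * (\<Sum>i<n. (y i)\<^sup>2)"
    using rayleigh_maximizer_nonneg[of n M, OF n M] by blast
  have eig: "mv n M x i = bil n M x x * x i" if "i < n" for i
    using rayleigh_attained_imp_eigen[OF sym x(3) _ that] x(2) by simp
  have "\<exists>i<n. x i \<noteq> 0"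
  proof (rule ccontr)
    assume "\<not> ?thesis"
    then show False using x(2) by simp
  qed
  then have in_spec: "bil n M x x \<in> spectrum ?A"
    using eig unfolding spectrum_def by (auto simp: eigenvalue_iff_mv)
  have le: "k \<le> bil n M x x" if "k \<in> spectrum ?A" for k
  proof -
    obtain y where y: "\<exists>i<n. y i \<noteq> 0" "\<And>i. i < n \<Longrightarrow> mv n M y i = k * y i"
      using \<open>k \<in> spectrum ?A\<close> unfolding spectrum_def mem_Collect_eq eigenvalue_iff_mv by blast
    have "(\<Sum>i<n. (y i)\<^sup>2) \<noteq> 0" using y(1) by (auto simp: sum_nonneg_eq_0_iff)
    then have "(\<Sum>i<n. (y i)\<^sup>2) > 0" using sum_nonneg[of "{..<n}" "\<lambda>i. (y i)\<^sup>2"] by simp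
    moreover have "k * (\<Sum>i<n. (y i)\<^sup>2) \<le> bil n M x x * (\<Sum>i<n. (y i)\<^sup>2)"
      using x(3)[of y] bil_eigen[OF y(2)] by simp
    ultimately show ?thesis by simp
  qed
  have "finite (spectrum ?A)" by (rule card_finite_spectrum(1)[of _ n]) simp
  then have "top_eigenvalue n M = bil n M x x"
    unfolding top_eigenvalue_def using in_spec le by (intro Max_eqI) auto
  then show thesis using that[of x] x eig by simp
qed

section \<open>Summation by parts\<close>

lemma sum_mult_antimono_le:
  fixes c d x :: "nat \<Rightarrow> real"
  assumes prefix: "\<And>p. p \<le> n \<Longrightarrow> (\<Sum>i<p. c i) \<le> (\<Sum>i<p. d i)"
    and mono: "\<And>i j. i \<le> j \<Longrightarrow> j < n \<Longrightarrow> x j \<le> x i" and nonneg: "\<And>i. i < n \<Longrightarrow> 0 \<le> x i"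
  shows "(\<Sum>i<n. c i * x i) \<le> (\<Sum>i<n. d i * x i)"
proof (cases n)
  case (Suc l)
  \<comment> \<open>Abel summation as an induction: the boundary term, last weight times last prefix
    difference, is kept on the left. Lowering that weight from \<open>x m\<close> to
    \<open>x (Suc m)\<close> only helps, as prefix differences are nonnegative.\<close>
  have "x m * ((\<Sum>i<Suc m. d i) - (\<Sum>i<Suc m. c i)) \<le> (\<Sum>i<Suc m. d i * x i) - (\<Sum>i<Suc m. c i * x i)"
    if "m < n" for m
    using that
  proof (induction m)
    case 0 then show ?case by (simp add: algebra_simps)
  next
    case (Suc m)
    have "x (Suc m) * ((\<Sum>i<Suc m. d i) - (\<Sum>i<Suc m. c i)) \<le> x m * ((\<Sum>i<Suc m. d i) - (\<Sum>i<Suc m. c i))"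
      using prefix[of "Suc m"] mono[of m "Suc m"] Suc.prems by (intro mult_right_mono) auto
    then show ?case using Suc by (simp add: algebra_simps)
  qed
  from this[of l] have "x l * ((\<Sum>i<n. d i) - (\<Sum>i<n. c i)) \<le> (\<Sum>i<n. d i * x i) - (\<Sum>i<n. c i * x i)"
    using Suc by simp
  moreover have "0 \<le> x l * ((\<Sum>i<n. d i) - (\<Sum>i<n. c i))"
    using nonneg[of l] prefix[of n] Suc by (intro mult_nonneg_nonneg) auto
  ultimately show ?thesis by linarith
qed simp

lemma bil_le_if_prefix_sums_le:
  assumes prefix: "\<And>p q. p \<le> n \<Longrightarrow> q \<le> n \<Longrightarrow> (\<Sum>i<p. \<Sum>j<q. M i j) \<le> (\<Sum>i<p. \<Sum>j<q. N i j)"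
    and mono: "\<And>i j. i \<le> j \<Longrightarrow> j < n \<Longrightarrow> x j \<le> x i" and nonneg: "\<And>i. i < n \<Longrightarrow> 0 \<le> x i"
  shows "bil n M x x \<le> bil n N x x"
proof -
  have "(\<Sum>i<n. mv n M x i * x i) \<le> (\<Sum>i<n. mv n N x i * x i)"
  proof (rule sum_mult_antimono_le[OF _ mono nonneg])
    fix p assume p: "p \<le> n"
    \<comment> \<open>Exchanging the sums makes the column sums of the first \<open>p\<close> rows
      the coefficients of a second summation by parts.\<close>
    have swap: "(\<Sum>i<p. mv n L x i) = (\<Sum>j<n. (\<Sum>i<p. L i j) * x j)" for L
      unfolding mv_def sum_distrib_right by (rule sum.swap)
    show "(\<Sum>i<p. mv n M x i) \<le> (\<Sum>i<p. mv n N x i)"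
      unfolding swap
    proof (rule sum_mult_antimono_le[OF _ mono nonneg])
      fix q assume "q \<le> n"
      then show "(\<Sum>j<q. \<Sum>i<p. M i j) \<le> (\<Sum>j<q. \<Sum>i<p. N i j)"
        using prefix[OF p] by (subst (1 2) sum.swap) simp
    qed
  qed
  then show ?thesis unfolding bil_def by (simp add: mult.commute)
qed

subsection \<open>Comparison with threshold graphs\<close>

text \<open>The join of a clique on \<open>a\<close> vertices with the disjoint union of
  \<open>s\<close> isolated vertices and a clique on the remaining ones. Unlike in
  \<open>H_graph\<close> and \<open>L_graph\<close>, the isolated vertices of the union get the last
  labels, so that degrees decrease along the labels.\<close>

definition threshold_rel :: "nat \<Rightarrow> nat \<Rightarrow> nat \<Rightarrow> nat rel" where
  "threshold_rel n a s = {(i, j). i < n \<and> j < n \<and> i \<noteq> j \<and> (i < a \<or> j < a \<or> i < n - s \<and> j < n - s)}"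

text \<open>\<open>\<theta> = 0\<close> gives the adjacency matrix and \<open>\<theta> = 1\<close>
  the signless Laplacian; the comparison works for every \<open>\<theta> \<ge> 0\<close>.\<close>

definition wmat :: "real \<Rightarrow> nat rel \<Rightarrow> nat \<Rightarrow> nat \<Rightarrow> real" where
  "wmat \<theta> E i j = \<theta> * (if i = j then real (deg E i) else 0) + (if (i, j) \<in> E then 1 else 0)"

lemma simple_on_threshold_rel: "simple_on n (threshold_rel n a s)"
  unfolding simple_on_def threshold_rel_def sym_def irrefl_def by auto

lemma threshold_rel_Image:
  assumes "a + s < n" "i < n"
  shows "threshold_rel n a s `` {i} =
    (if i < a then {..<n} - {i} else if i < n - s then {..<n - s} - {i} else {..<a})"
  using assms unfolding threshold_rel_def by auto

text \<open>Each neighbourhood is an initial segment with \<open>i\<close> itself removed, so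
  \<open>{..<q}\<close> meets it in as many elements as the degree and the missing loop
  permit.\<close>

lemma card_threshold_rel_Image:
  assumes "a + s < n" "i < q" "q \<le> n"
  shows "card (threshold_rel n a s `` {i} \<inter> {..<q}) =
    min (if i < a then n - 1 else if i < n - s then n - s - 1 else a) (q - 1)"
proof -
  have i: "i < n" using assms by simp
  note image = threshold_rel_Image[OF assms(1) i]
  consider "i < a" | "\<not> i < a" "i < n - s" | "\<not> i < a" "\<not> i < n - s" by blast
  then show ?thesis
  proof cases
    case 1
    have "({..<n} - {i}) \<inter> {..<q} = {..<q} - {i}" using assms by auto
    then have "threshold_rel n a s `` {i} \<inter> {..<q} = {..<q} - {i}" using 1 image by simp
    then show ?thesis using 1 assms by simp
  next
    case 2
    have "({..<n - s} - {i}) \<inter> {..<q} = {..<min (n - s) q} - {i}" by auto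
    then have "threshold_rel n a s `` {i} \<inter> {..<q} = {..<min (n - s) q} - {i}" using 2 image by simp
    moreover have "card ({..<min (n - s) q} - {i}) = min (n - s) q - 1" using 2 assms by simp
    moreover have "min (n - s) q - 1 = min (n - s - 1) (q - 1)" by (simp add: min_def)
    ultimately show ?thesis using 2 by simp
  next
    case 3
    have "{..<a} \<inter> {..<q} = {..<a}" using 3 assms by auto
    then have "threshold_rel n a s `` {i} \<inter> {..<q} = {..<a}" using 3 image by simp
    then show ?thesis using 3 assms by simp
  qed
qed

lemma deg_threshold_rel:
  assumes "a + s < n" "i < n"
  shows "deg (threshold_rel n a s) i = (if i < a then n - 1 else if i < n - s then n - s - 1 else a)"
proof -
  have "threshold_rel n a s `` {i} \<inter> {..<n} = threshold_rel n a s `` {i}"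
    unfolding threshold_rel_def by auto
  then show ?thesis using card_threshold_rel_Image[of a s n i n] assms unfolding deg_def by auto
qed

lemma sum_if_less_nat: "p \<le> n \<Longrightarrow> (\<Sum>i<p. if i < m then b else 0) = b * min p m" for b p m n :: nat
proof -
  have "(\<Sum>i<p. if i < m then b else 0) = (\<Sum>i\<in>{..<p} \<inter> {i. i < m}. b)"
    by (simp only: sum.inter_restrict[OF finite_lessThan] mem_Collect_eq)
  moreover have "{..<p} \<inter> {i. i < m} = {..<min p m}" by auto
  ultimately show ?thesis by simp
qed

text \<open>Slice each truncated degree into layers: a base for everyone, a second layer only where
  \<open>d i > a\<close>, a third only where \<open>d i \<ge> n - s\<close>. The two counts limit
  how many of any \<open>p\<close> vertices reach each upper layer, and the threshold sequence fills
  the layers to these limits. No monotonicity of \<open>d\<close> enters, so any vertex order is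
  allowed.\<close>

lemma sum_min_deg_le:
  fixes d :: "nat \<Rightarrow> nat"
  assumes as: "a + s < n" and d: "\<And>i. i < n \<Longrightarrow> d i < n"
    and low: "s \<le> card {i. i < n \<and> d i \<le> a}" and mid: "n - a \<le> card {i. i < n \<and> d i < n - s}"
    and p: "p \<le> n"
  shows "(\<Sum>i<p. min (d i) c) \<le>
    (\<Sum>i<p. min (if i < a then n - 1 else if i < n - s then n - s - 1 else a) c)"
proof -
  \<comment> \<open>Layer heights between the three possible degrees \<open>a\<close>,
    \<open>n - s - 1\<close> and \<open>n - 1\<close> of the threshold graph, all cut off at
    \<open>c\<close>.\<close>
  define \<alpha> \<beta> \<gamma> where "\<alpha> = min a c" and "\<beta> = min (n - s - 1) c - min a c"
    and "\<gamma> = min (n - 1) c - min (n - s - 1) c"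
  have count: "card {i. i < p \<and> \<not> Q i} \<le> min p m" if "n - m \<le> card {i. i < n \<and> Q i}" for Q m
  proof -
    have "card {i. i < p \<and> \<not> Q i} \<le> p" using card_mono[of "{..<p}" "{i. i < p \<and> \<not> Q i}"] by auto
    moreover have "card {i. i < p \<and> \<not> Q i} \<le> card {i. i < n \<and> \<not> Q i}"
      using p by (intro card_mono) auto
    moreover have "{i. i < n \<and> \<not> Q i} = {..<n} - {i. i < n \<and> Q i}" by auto
    then have "card {i. i < n \<and> \<not> Q i} = n - card {i. i < n \<and> Q i}"
      by (simp add: card_Diff_subset subset_eq)
    ultimately show ?thesis using that by auto
  qed
  have sum_ind: "(\<Sum>i<p. if Q i then 0 else b) = b * card {i. i < p \<and> \<not> Q i}" for Q and b :: nat
  proof -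
    have "(\<Sum>i<p. if Q i then 0 else b) = (\<Sum>i<p. if \<not> Q i then b else 0)" by (intro sum.cong) auto
    also have "\<dots> = (\<Sum>i\<in>{..<p} \<inter> {i. \<not> Q i}. b)"
      by (simp only: sum.inter_restrict[OF finite_lessThan] mem_Collect_eq)
    also have "{..<p} \<inter> {i. \<not> Q i} = {i. i < p \<and> \<not> Q i}" by auto
    finally show ?thesis by simp
  qed
  have "(\<Sum>i<p. min (d i) c) \<le> (\<Sum>i<p. \<alpha> + (if d i \<le> a then 0 else \<beta>) + (if d i < n - s then 0 else \<gamma>))"
  proof (rule sum_mono)
    fix i assume "i \<in> {..<p}"
    then have "d i < n" using d p by simp
    then show "min (d i) c \<le> \<alpha> + (if d i \<le> a then 0 else \<beta>) + (if d i < n - s then 0 else \<gamma>)"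
      using as unfolding \<alpha>_def \<beta>_def \<gamma>_def by (auto simp: min_def)
  qed
  also have "\<dots> = \<alpha> * p + \<beta> * card {i. i < p \<and> \<not> d i \<le> a} + \<gamma> * card {i. i < p \<and> \<not> d i < n - s}"
    by (simp only: sum.distrib sum_ind) simp
  also have "\<dots> \<le> \<alpha> * p + \<beta> * min p (n - s) + \<gamma> * min p a"
    using count[of "n - s" "\<lambda>i. d i \<le> a"] count[of a "\<lambda>i. d i < n - s"] low mid as
    by (intro add_mono mult_left_mono) auto
  also have "\<dots> = (\<Sum>i<p. \<alpha> + (if i < n - s then \<beta> else 0) + (if i < a then \<gamma> else 0))"
    using p by (simp add: sum.distrib sum_if_less_nat)
  also have "\<dots> = (\<Sum>i<p. min (if i < a then n - 1 else if i < n - s then n - s - 1 else a) c)"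
    using as unfolding \<alpha>_def \<beta>_def \<gamma>_def by (intro sum.cong) (auto simp: min_def)
  finally show ?thesis .
qed

lemma deg_less:
  assumes "simple_on n E" "i < n"
  shows "deg E i < n"
proof -
  have "E `` {i} \<subseteq> {..<n} - {i}" by (auto dest: simple_onD(2,4)[OF assms(1)])
  then have "card (E `` {i}) \<le> card ({..<n} - {i})" by (intro card_mono) auto
  then show ?thesis using assms(2) unfolding deg_def by simp
qed

lemma wmat_sym: "simple_on n E \<Longrightarrow> wmat \<theta> E i j = wmat \<theta> E j i"
  unfolding wmat_def using simple_onD(3) by auto

lemma wmat_nonneg: "0 \<le> \<theta> \<Longrightarrow> 0 \<le> wmat \<theta> E i j"
  unfolding wmat_def by simp

lemma sum_adjacent:
  fixes q :: nat
  shows "(\<Sum>j<q. if (i, j) \<in> E then f j else 0) = (\<Sum>j\<in>E `` {i} \<inter> {..<q}. f j)"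
proof -
  have "E `` {i} \<inter> {..<q} = {..<q} \<inter> {j. (i, j) \<in> E}" by auto
  then show ?thesis by (simp only: sum.inter_restrict[OF finite_lessThan] mem_Collect_eq)
qed

text \<open>With \<open>p \<le> q\<close> the rectangle contains the diagonal entry of each of its
  rows, so every row contributes its full degree.\<close>

lemma wmat_prefix_sum:
  assumes "p \<le> q"
  shows "(\<Sum>i<p. \<Sum>j<q. wmat \<theta> E i j) =
    \<theta> * real (\<Sum>i<p. deg E i) + real (\<Sum>i<p. card (E `` {i} \<inter> {..<q}))"
proof -
  have "(\<Sum>j<q. wmat \<theta> E i j) = \<theta> * real (deg E i) + real (card (E `` {i} \<inter> {..<q}))" if "i < p" for i
    using that assms unfolding wmat_def
    by (simp add: sum.distrib sum_adjacent flip: sum_distrib_left)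
  then have "(\<Sum>i<p. \<Sum>j<q. wmat \<theta> E i j) = (\<Sum>i<p. \<theta> * real (deg E i) + real (card (E `` {i} \<inter> {..<q})))"
    by (intro sum.cong) auto
  then show ?thesis by (simp add: sum.distrib sum_distrib_left)
qed

lemma wmat_prefix_sum_le_threshold:
  assumes E: "simple_on n E" and as: "a + s < n" and \<theta>: "0 \<le> \<theta>"
    and low: "s \<le> card {i. i < n \<and> deg E i \<le> a}" and mid: "n - a \<le> card {i. i < n \<and> deg E i < n - s}"
    and pq: "p \<le> n" "q \<le> n"
  shows "(\<Sum>i<p. \<Sum>j<q. wmat \<theta> E i j) \<le> (\<Sum>i<p. \<Sum>j<q. wmat \<theta> (threshold_rel n a s) i j)"
proof -
  let ?T = "threshold_rel n a s"
  let ?d = "\<lambda>i. if i < a then n - 1 else if i < n - s then n - s - 1 else a"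
  have main: "(\<Sum>i<p. \<Sum>j<q. wmat \<theta> E i j) \<le> (\<Sum>i<p. \<Sum>j<q. wmat \<theta> ?T i j)"
    if "p \<le> q" "q \<le> n" for p q
  proof -
    note le = sum_min_deg_le[OF as deg_less[OF E] low mid, of p]
    \<comment> \<open>Degrees never exceed \<open>n - 1\<close>, so the cut-off
      \<open>c = n - 1\<close> yields plain degree sums for the diagonal part; the cut-off
      \<open>q - 1\<close> below treats the adjacency part.\<close>
    have "(\<Sum>i<p. deg E i) = (\<Sum>i<p. min (deg E i) (n - 1))"
    proof (intro sum.cong refl)
      fix i assume "i \<in> {..<p}"
      then have "deg E i < n" using that deg_less[OF E, of i] by simp
      then show "deg E i = min (deg E i) (n - 1)" by simp
    qed
    also have "\<dots> \<le> (\<Sum>i<p. min (?d i) (n - 1))" using that by (intro le) auto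
    also have "\<dots> = (\<Sum>i<p. deg ?T i)"
      using that as by (intro sum.cong) (auto simp: deg_threshold_rel)
    finally have 1: "(\<Sum>i<p. deg E i) \<le> (\<Sum>i<p. deg ?T i)" .
    have "(\<Sum>i<p. card (E `` {i} \<inter> {..<q})) \<le> (\<Sum>i<p. min (deg E i) (q - 1))"
    proof (rule sum_mono)
      fix i assume i: "i \<in> {..<p}"
      have "card (E `` {i} \<inter> {..<q}) \<le> deg E i"
        unfolding deg_def by (intro card_mono finite_Image simple_on_finite[OF E]) auto
      moreover have "E `` {i} \<inter> {..<q} \<subseteq> {..<q} - {i}" using simple_onD(4)[OF E] by auto
      then have "card (E `` {i} \<inter> {..<q}) \<le> card ({..<q} - {i})" by (intro card_mono) auto
      ultimately show "card (E `` {i} \<inter> {..<q}) \<le> min (deg E i) (q - 1)" using i that by simp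
    qed
    also have "\<dots> \<le> (\<Sum>i<p. min (?d i) (q - 1))" using that by (intro le) auto
    also have "\<dots> = (\<Sum>i<p. card (?T `` {i} \<inter> {..<q}))"
      using that as by (intro sum.cong) (auto simp: card_threshold_rel_Image)
    finally have 2: "(\<Sum>i<p. card (E `` {i} \<inter> {..<q})) \<le> (\<Sum>i<p. card (?T `` {i} \<inter> {..<q}))" .
    show ?thesis
      unfolding wmat_prefix_sum[OF that(1)] using 1 2 \<theta>
      by (intro add_mono mult_left_mono of_nat_mono) auto
  qed
  show ?thesis
  proof (cases "p \<le> q")
    case True then show ?thesis using main pq by simp
  next
    case False
    have swap: "(\<Sum>i<p. \<Sum>j<q. wmat \<theta> F i j) = (\<Sum>j<q. \<Sum>i<p. wmat \<theta> F j i)" if "simple_on n F" for F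
      by (subst sum.swap) (simp only: wmat_sym[OF that])
    show ?thesis
      unfolding swap[OF E] swap[OF simple_on_threshold_rel] using main[of q p] False pq by simp
  qed
qed

section \<open>Relabelling of vertices\<close>

lemma sorting_permutation:
  fixes x :: "nat \<Rightarrow> real"
  obtains \<pi> where "bij_betw \<pi> {..<n} {..<n}" "\<And>i j. i \<le> j \<Longrightarrow> j < n \<Longrightarrow> x (\<pi> j) \<le> x (\<pi> i)"
proof -
  define xs where "xs = sort_key (\<lambda>i. - x i) [0..<n]"
  have "bij_betw ((!) xs) {..<n} {..<n}"
    by (rule bij_betw_nth) (auto simp: xs_def)
  moreover have "x (xs ! j) \<le> x (xs ! i)" if "i \<le> j" "j < n" for i j
  proof -
    have "sorted (map (\<lambda>i. - x i) xs)" unfolding xs_def by simp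
    then have "map (\<lambda>i. - x i) xs ! i \<le> map (\<lambda>i. - x i) xs ! j"
      using that by (intro sorted_nth_mono) (auto simp: xs_def)
    then show ?thesis using that by (simp add: xs_def)
  qed
  ultimately show thesis by (rule that)
qed

lemma deg_relabel:
  assumes E: "simple_on n E" and F: "simple_on n F" and \<pi>: "bij_betw \<pi> {..<n} {..<n}"
    and iso: "\<And>i j. i < n \<Longrightarrow> j < n \<Longrightarrow> (\<pi> i, \<pi> j) \<in> E \<longleftrightarrow> (i, j) \<in> F" and i: "i < n"
  shows "deg F i = deg E (\<pi> i)"
proof -
  have inj: "inj_on \<pi> {..<n}" and im: "\<pi> ` {..<n} = {..<n}" using \<pi> by (auto simp: bij_betw_def)
  have "E `` {\<pi> i} \<subseteq> \<pi> ` (F `` {i})"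
  proof
    fix w assume w: "w \<in> E `` {\<pi> i}"
    then have "w \<in> \<pi> ` {..<n}" using im simple_onD(2)[OF E] by auto
    then show "w \<in> \<pi> ` (F `` {i})" using w i iso by auto
  qed
  moreover have "\<pi> ` (F `` {i}) \<subseteq> E `` {\<pi> i}" using i iso simple_onD(2)[OF F] by auto
  ultimately have "\<pi> ` (F `` {i}) = E `` {\<pi> i}" by simp
  moreover have "inj_on \<pi> (F `` {i})"
    by (rule inj_on_subset[OF inj]) (use simple_onD(2)[OF F] in auto)
  ultimately show ?thesis unfolding deg_def by (metis card_image)
qed

lemma wmat_relabel:
  assumes E: "simple_on n E" and F: "simple_on n F" and \<pi>: "bij_betw \<pi> {..<n} {..<n}"
    and iso: "\<And>i j. i < n \<Longrightarrow> j < n \<Longrightarrow> (\<pi> i, \<pi> j) \<in> E \<longleftrightarrow> (i, j) \<in> F" and ij: "i < n" "j < n"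
  shows "wmat \<theta> F i j = wmat \<theta> E (\<pi> i) (\<pi> j)"
proof -
  have "\<pi> i = \<pi> j \<longleftrightarrow> i = j" using \<pi> ij by (auto simp: bij_betw_def inj_on_eq_iff)
  then show ?thesis
    using deg_relabel[OF E F \<pi> iso ij(1)] iso[OF ij] unfolding wmat_def by (cases "i = j") simp_all
qed

lemma mv_relabel:
  assumes \<pi>: "bij_betw \<pi> {..<n} {..<n}" and N: "\<And>i j. i < n \<Longrightarrow> j < n \<Longrightarrow> N i j = M (\<pi> i) (\<pi> j)"
    and i: "i < n"
  shows "mv n N (\<lambda>i. x (\<pi> i)) i = mv n M x (\<pi> i)"
proof -
  have "mv n N (\<lambda>i. x (\<pi> i)) i = (\<Sum>j<n. M (\<pi> i) (\<pi> j) * x (\<pi> j))"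
    unfolding mv_def using N i by (intro sum.cong) auto
  also have "\<dots> = mv n M x (\<pi> i)"
    unfolding mv_def by (rule sum.reindex_bij_betw[OF \<pi>, of "\<lambda>j. M (\<pi> i) j * x j"])
  finally show ?thesis .
qed

lemma top_eigenvalue_relabel:
  assumes \<pi>: "bij_betw \<pi> {..<n} {..<n}" and N: "\<And>i j. i < n \<Longrightarrow> j < n \<Longrightarrow> N i j = M (\<pi> i) (\<pi> j)"
  shows "top_eigenvalue n N = top_eigenvalue n M"
proof -
  have sub: "spectrum (Matrix.mat n n (\<lambda>(i, j). M i j)) \<subseteq> spectrum (Matrix.mat n n (\<lambda>(i, j). N i j))"
    if \<pi>: "bij_betw \<pi> {..<n} {..<n}" and N: "\<And>i j. i < n \<Longrightarrow> j < n \<Longrightarrow> N i j = M (\<pi> i) (\<pi> j)"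
    for \<pi> and M N :: "nat \<Rightarrow> nat \<Rightarrow> real"
  proof
    fix k assume "k \<in> spectrum (Matrix.mat n n (\<lambda>(i, j). M i j))"
    then obtain x where x: "\<exists>i<n. x i \<noteq> 0" "\<forall>i<n. mv n M x i = k * x i"
      unfolding spectrum_def mem_Collect_eq eigenvalue_iff_mv by blast
    obtain j where j: "j < n" "x j \<noteq> 0" using x(1) by blast
    then have "j \<in> \<pi> ` {..<n}" using \<pi> by (simp add: bij_betw_def)
    then have "\<exists>i<n. x (\<pi> i) \<noteq> 0" using j by auto
    moreover have "mv n N (\<lambda>i. x (\<pi> i)) i = k * x (\<pi> i)" if i: "i < n" for i
    proof -
      have "\<pi> i < n" using \<pi> i by (auto simp: bij_betw_def)
      then show ?thesis using mv_relabel[where M = M and N = N and x = x, OF \<pi> N i] x(2) by simp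
    qed
    ultimately show "k \<in> spectrum (Matrix.mat n n (\<lambda>(i, j). N i j))"
      unfolding spectrum_def mem_Collect_eq eigenvalue_iff_mv
      by (intro exI[of _ "\<lambda>i. x (\<pi> i)"]) simp
  qed
  define \<sigma> where "\<sigma> = inv_into {..<n} \<pi>"
  have \<sigma>: "bij_betw \<sigma> {..<n} {..<n}" unfolding \<sigma>_def by (rule bij_betw_inv_into[OF \<pi>])
  have "M i j = N (\<sigma> i) (\<sigma> j)" if "i < n" "j < n" for i j
  proof -
    have "\<pi> (\<sigma> i) = i" "\<pi> (\<sigma> j) = j" "\<sigma> i < n" "\<sigma> j < n"
      using that \<pi> \<sigma> unfolding \<sigma>_def by (auto simp: bij_betw_def f_inv_into_f)
    then show ?thesis using N by simp
  qed
  then have "spectrum (Matrix.mat n n (\<lambda>(i, j). M i j)) = spectrum (Matrix.mat n n (\<lambda>(i, j). N i j))"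
    using sub[where M = M and N = N, OF \<pi> N] sub[where M = N and N = M, OF \<sigma>] by blast
  then show ?thesis unfolding top_eigenvalue_def by simp
qed

section \<open>The case of equality\<close>

text \<open>Positivity spreads along edges: a positive entry at \<open>j\<close> makes the product
  positive at each neighbour \<open>i\<close>, so \<open>y i\<close> cannot be 0. Since
  \<open>1 \<le> a\<close>, vertex 0 is adjacent to all others, so two steps reach every
  vertex.\<close>

lemma threshold_eigenvector_pos:
  assumes a: "1 \<le> a" and as: "a + s < n" and \<theta>: "0 \<le> \<theta>"
    and y: "\<And>i. i < n \<Longrightarrow> 0 \<le> y i" "(\<Sum>i<n. (y i)\<^sup>2) = 1"
    and eig: "\<And>i. i < n \<Longrightarrow> mv n (wmat \<theta> (threshold_rel n a s)) y i = k * y i"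
  shows "i < n \<Longrightarrow> 0 < y i"
proof -
  let ?T = "threshold_rel n a s"
  have step: "0 < y i" if ij: "(i, j) \<in> ?T" and yj: "0 < y j" for i j
  proof -
    have i: "i < n" and j: "j < n" using ij unfolding threshold_rel_def by auto
    have "1 \<le> wmat \<theta> ?T i j" using ij \<theta> unfolding wmat_def by simp
    then have "0 < wmat \<theta> ?T i j * y j" using yj by simp
    also have "\<dots> \<le> mv n (wmat \<theta> ?T) y i"
      unfolding mv_def using j y(1) wmat_nonneg[OF \<theta>]
      by (intro member_le_sum[of j "{..<n}" "\<lambda>j. wmat \<theta> ?T i j * y j"]) auto
    finally have "y i \<noteq> 0" using eig[OF i] by auto
    then show ?thesis using y(1)[OF i] by simp
  qed
  obtain j where j: "j < n" "0 < y j"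
  proof -
    have "\<exists>j<n. y j \<noteq> 0"
    proof (rule ccontr)
      assume "\<not> ?thesis"
      then show False using y(2) by simp
    qed
    then show thesis using that y(1) by (metis order_le_less)
  qed
  have 0: "0 < y 0"
  proof (cases "j = 0")
    case False
    then show ?thesis using step[of 0 j] j a unfolding threshold_rel_def by auto
  qed (use j in simp)
  assume "i < n"
  then show "0 < y i"
    using step[of i 0] 0 a unfolding threshold_rel_def by (cases "i = 0") auto
qed

lemma mv_wmat:
  assumes "simple_on n E" "i < n"
  shows "mv n (wmat \<theta> E) y i = \<theta> * real (deg E i) * y i + (\<Sum>j\<in>E `` {i}. y j)"
proof -
  have "E `` {i} \<inter> {..<n} = E `` {i}" using simple_onD(2)[OF assms(1)] by auto
  have "mv n (wmat \<theta> E) y i =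
    (\<Sum>j<n. if i = j then \<theta> * real (deg E i) * y j else 0) + (\<Sum>j<n. if (i, j) \<in> E then y j else 0)"
    unfolding mv_def wmat_def sum.distrib[symmetric] by (intro sum.cong) (auto simp: algebra_simps)
  also have "(\<Sum>j<n. if (i, j) \<in> E then y j else 0) = (\<Sum>j\<in>E `` {i}. y j)"
    unfolding sum_adjacent \<open>E `` {i} \<inter> {..<n} = E `` {i}\<close> ..
  finally show ?thesis using assms(2) by simp
qed

text \<open>With positive entries in \<open>y\<close>, enlarging the neighbourhood of
  \<open>i\<close> strictly increases the neighbour sum and does not decrease the degree term.
  Equality of the products thus excludes proper inclusion.\<close>

lemma nested_nbrs_eq_if_mv_eq:
  assumes E: "simple_on n E" and F: "simple_on n F" and i: "i < n" and sub: "E `` {i} \<subseteq> F `` {i}"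
    and y: "\<And>j. j < n \<Longrightarrow> 0 < y j" and \<theta>: "0 \<le> \<theta>" and eq: "mv n (wmat \<theta> E) y i = mv n (wmat \<theta> F) y i"
  shows "E `` {i} = F `` {i}"
proof (rule ccontr)
  assume neq: "E `` {i} \<noteq> F `` {i}"
  have fin: "finite (F `` {i})" using simple_on_finite[OF F] by (rule finite_Image)
  obtain w where w: "w \<in> F `` {i} - E `` {i}" using neq sub by auto
  have "(\<Sum>j\<in>E `` {i}. y j) < (\<Sum>j\<in>F `` {i}. y j)"
    using y simple_onD(2)[OF F] w sub fin by (intro sum_strict_mono2[of _ _ w]) (auto intro: less_imp_le)
  moreover have "deg E i \<le> deg F i" unfolding deg_def using sub fin by (intro card_mono)
  then have "\<theta> * real (deg E i) * y i \<le> \<theta> * real (deg F i) * y i"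
    using \<theta> y[OF i] by (intro mult_right_mono mult_left_mono) auto
  ultimately show False using eq unfolding mv_wmat[OF E i] mv_wmat[OF F i] by linarith
qed

text \<open>Vertices of \<open>threshold_rel\<close> see everything, or everything outside the independent set, or only
  the dominating vertices; treating the three kinds in this order makes each inclusion available.\<close>

lemma eq_threshold_if_mv_eq:
  assumes E: "simple_on n E" and as: "a + s < n" and y: "\<And>j. j < n \<Longrightarrow> 0 < y j" and \<theta>: "0 \<le> \<theta>"
    and eq: "\<And>i. i < n \<Longrightarrow> mv n (wmat \<theta> E) y i = mv n (wmat \<theta> (threshold_rel n a s)) y i"
  shows "E = threshold_rel n a s"
proof -
  let ?T = "threshold_rel n a s"
  note T = simple_on_threshold_rel[of n a s]
  have dom: "E `` {i} = ?T `` {i}" if "i < a" for i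
  proof -
    have i: "i < n" using that as by simp
    have "E `` {i} \<subseteq> ?T `` {i}"
      using simple_onD(2,4)[OF E] that by (subst threshold_rel_Image[OF as i]) auto
    then show ?thesis by (rule nested_nbrs_eq_if_mv_eq[OF E T i _ y \<theta> eq[OF i]])
  qed
  \<comment> \<open>The inclusion runs the other way here: by symmetry, the dominating rows already
    force every arc from \<open>i\<close> into \<open>{..<a}\<close>.\<close>
  have ind: "E `` {i} = ?T `` {i}" if "n - s \<le> i" "i < n" for i
  proof -
    have "?T `` {i} \<subseteq> E `` {i}"
    proof
      fix j assume "j \<in> ?T `` {i}"
      then have j: "j < a" "i \<noteq> j" using that as unfolding threshold_rel_def by auto
      then have "i \<in> ?T `` {j}" using that as unfolding threshold_rel_def by auto
      then have "(j, i) \<in> E" using dom[OF j(1)] by blast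
      then show "j \<in> E `` {i}" using simple_onD(3)[OF E] by blast
    qed
    then show ?thesis using nested_nbrs_eq_if_mv_eq[OF T E that(2) _ y \<theta> eq[OF that(2), symmetric]] by simp
  qed
  \<comment> \<open>An arc into the last \<open>s\<close> vertices would show up in their rows,
    which \<open>ind\<close> has settled.\<close>
  have mid: "E `` {i} = ?T `` {i}" if "a \<le> i" "i < n - s" for i
  proof -
    have i: "i < n" using that by simp
    have "E `` {i} \<subseteq> {..<n - s} - {i}"
    proof
      fix j assume j: "j \<in> E `` {i}"
      then have ji: "i \<in> E `` {j}" "j < n" "j \<noteq> i" using simple_onD[OF E] by blast+
      have "j < n - s"
      proof (rule ccontr)
        assume "\<not> j < n - s"
        then have "i \<in> ?T `` {j}" using ji ind[of j] by simp
        then show False using that \<open>\<not> j < n - s\<close> as unfolding threshold_rel_def by auto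
      qed
      then show "j \<in> {..<n - s} - {i}" using ji by simp
    qed
    then have "E `` {i} \<subseteq> ?T `` {i}" using that by (subst threshold_rel_Image[OF as i]) auto
    then show ?thesis by (rule nested_nbrs_eq_if_mv_eq[OF E T i _ y \<theta> eq[OF i]])
  qed
  have "E `` {i} = ?T `` {i}" for i
  proof (cases "i < n")
    case True then show ?thesis using dom ind mid by (meson not_le)
  next
    case False then show ?thesis using simple_onD(1)[OF E] simple_onD(1)[OF T] by auto
  qed
  then show ?thesis by (auto simp: set_eq_iff)
qed

lemma top_eigenvalue_le_threshold:
  assumes E: "simple_on n E" and a: "1 \<le> a" and as: "a + s < n" and \<theta>: "0 \<le> \<theta>"
    and low: "s \<le> card {i. i < n \<and> deg E i \<le> a}" and mid: "n - a \<le> card {i. i < n \<and> deg E i < n - s}"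
  shows "top_eigenvalue n (wmat \<theta> E) \<le> top_eigenvalue n (wmat \<theta> (threshold_rel n a s))"
    and "top_eigenvalue n (wmat \<theta> E) = top_eigenvalue n (wmat \<theta> (threshold_rel n a s)) \<Longrightarrow>
      \<exists>\<pi>. bij_betw \<pi> {..<n} {..<n} \<and> (\<forall>i<n. \<forall>j<n. (\<pi> i, \<pi> j) \<in> E \<longleftrightarrow> (i, j) \<in> threshold_rel n a s)"
proof -
  let ?T = "threshold_rel n a s"
  let ?k = "top_eigenvalue n (wmat \<theta> E)" and ?kT = "top_eigenvalue n (wmat \<theta> ?T)"
  have n: "1 \<le> n" using as by simp
  note symT = wmat_sym[OF simple_on_threshold_rel]
  obtain x where x: "\<And>i. 0 \<le> x i" "(\<Sum>i<n. (x i)\<^sup>2) = 1"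
    "\<And>i. i < n \<Longrightarrow> mv n (wmat \<theta> E) x i = ?k * x i"
    by (rule top_eigenvalue_nonneg_sym[OF n wmat_nonneg[OF \<theta>] wmat_sym[OF E]]) (rule that)
  obtain maxT: "\<And>y. bil n (wmat \<theta> ?T) y y \<le> ?kT * (\<Sum>i<n. (y i)\<^sup>2)"
    by (rule top_eigenvalue_nonneg_sym[OF n wmat_nonneg[OF \<theta>] symT]) (rule that)
  obtain \<pi> where \<pi>: "bij_betw \<pi> {..<n} {..<n}" and mono: "\<And>i j. i \<le> j \<Longrightarrow> j < n \<Longrightarrow> x (\<pi> j) \<le> x (\<pi> i)"
    by (rule sorting_permutation) (rule that)
  have inj: "inj_on \<pi> {..<n}" and im: "\<pi> ` {..<n} = {..<n}" using \<pi> by (auto simp: bij_betw_def)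
  define y where "y i = x (\<pi> i)" for i
  \<comment> \<open>\<open>E\<close> relabelled so that its Perron vector, now \<open>y\<close>, is
    nonincreasing.\<close>
  define F where "F = {(i, j). i < n \<and> j < n \<and> (\<pi> i, \<pi> j) \<in> E}"
  have reindex: "(\<Sum>i<n. f (\<pi> i)) = (\<Sum>i<n. f i)" for f :: "nat \<Rightarrow> real"
    using sum.reindex_bij_betw[OF \<pi>] .
  have F: "simple_on n F"
    using simple_onD(3,4)[OF E] unfolding simple_on_def F_def sym_def irrefl_def by auto
  have iso: "(\<pi> i, \<pi> j) \<in> E \<longleftrightarrow> (i, j) \<in> F" if "i < n" "j < n" for i j using that unfolding F_def by simp
  note degF = deg_relabel[OF E F \<pi> iso]
  have mvF: "mv n (wmat \<theta> F) y i = ?k * y i" if "i < n" for i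
  proof -
    have "\<pi> i < n" using im that by auto
    then show ?thesis
      using mv_relabel[where N = "wmat \<theta> F" and M = "wmat \<theta> E" and x = x, OF \<pi> wmat_relabel[OF E F \<pi> iso] that] x(3)
      unfolding y_def by simp
  qed
  have y1: "(\<Sum>i<n. (y i)\<^sup>2) = 1" using reindex[of "\<lambda>i. (x i)\<^sup>2"] x(2) unfolding y_def by simp
  have card_deg: "card {i. i < n \<and> Q (deg F i)} = card {i. i < n \<and> Q (deg E i)}" for Q
  proof -
    have "{i. i < n \<and> Q (deg E i)} \<subseteq> \<pi> ` {i. i < n \<and> Q (deg F i)}"
    proof
      fix w assume w: "w \<in> {i. i < n \<and> Q (deg E i)}"
      then have "w \<in> \<pi> ` {..<n}" using im by auto
      then show "w \<in> \<pi> ` {i. i < n \<and> Q (deg F i)}" using w degF by auto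
    qed
    moreover have "\<pi> ` {i. i < n \<and> Q (deg F i)} \<subseteq> {i. i < n \<and> Q (deg E i)}" using im degF by auto
    ultimately have "\<pi> ` {i. i < n \<and> Q (deg F i)} = {i. i < n \<and> Q (deg E i)}" by simp
    moreover have "inj_on \<pi> {i. i < n \<and> Q (deg F i)}" by (rule inj_on_subset[OF inj]) auto
    then have "card (\<pi> ` {i. i < n \<and> Q (deg F i)}) = card {i. i < n \<and> Q (deg F i)}" by (rule card_image)
    ultimately show ?thesis by simp
  qed
  have "s \<le> card {i. i < n \<and> deg F i \<le> a}" using low card_deg[of "\<lambda>d. d \<le> a"] by simp
  moreover have "n - a \<le> card {i. i < n \<and> deg F i < n - s}" using mid card_deg[of "\<lambda>d. d < n - s"] by simp
  ultimately have "bil n (wmat \<theta> F) y y \<le> bil n (wmat \<theta> ?T) y y"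
    using wmat_prefix_sum_le_threshold[OF F as \<theta>] mono x(1)
    unfolding y_def by (intro bil_le_if_prefix_sums_le)
  moreover have bilF: "bil n (wmat \<theta> F) y y = ?k" using bil_eigen[OF mvF] y1 by simp
  ultimately have le: "?k \<le> bil n (wmat \<theta> ?T) y y" by simp
  then show "?k \<le> ?kT" using maxT[of y] y1 by simp
  assume eq: "?k = ?kT"
  \<comment> \<open>The value of the form at \<open>y\<close> is squeezed between the two equal
    eigenvalues, so \<open>y\<close> attains the Rayleigh bound of the threshold graph and is an
    eigenvector of it as well.\<close>
  have "bil n (wmat \<theta> ?T) y y = ?kT * (\<Sum>i<n. (y i)\<^sup>2)" using le maxT[of y] y1 eq by simp
  then have mvT: "mv n (wmat \<theta> ?T) y i = ?kT * y i" if "i < n" for i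
    using rayleigh_attained_imp_eigen[OF symT maxT _ that] by simp
  have pos: "0 < y i" if "i < n" for i
    using threshold_eigenvector_pos[OF a as \<theta> _ y1 mvT that] x(1) unfolding y_def by simp
  have "F = ?T"
    by (rule eq_threshold_if_mv_eq[OF F as pos \<theta>]) (use mvF mvT eq in auto)
  then have "\<forall>i<n. \<forall>j<n. (\<pi> i, \<pi> j) \<in> E \<longleftrightarrow> (i, j) \<in> ?T" unfolding F_def by auto
  then show "\<exists>\<pi>. bij_betw \<pi> {..<n} {..<n} \<and> (\<forall>i<n. \<forall>j<n. (\<pi> i, \<pi> j) \<in> E \<longleftrightarrow> (i, j) \<in> ?T)"
    using \<pi> by blast
qed

subsection \<open>Graphs as relations\<close>

lemma graphs_of_orderD:
  assumes "G \<in> graphs_of_order n"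
  shows "simple_on n (parcs G)" "pverts G = {..<n}" "graph_order G = n"
proof -
  from assms have "pair_graph G" and V: "pverts G = {..<n}" unfolding graphs_of_order_def by auto
  interpret pair_graph G by fact
  have "sym (parcs G)" using pair_sym_arcs unfolding symmetric_def by simp
  moreover have "irrefl (parcs G)" using pair_no_loops by (force simp: irrefl_def)
  moreover have "parcs G \<subseteq> {..<n} \<times> {..<n}" using wellformed' V by auto
  ultimately show "simple_on n (parcs G)" unfolding simple_on_def by blast
  show "pverts G = {..<n}" "graph_order G = n" using V unfolding graph_order_def by auto
qed

lemma graphs_of_orderI:
  assumes "simple_on n (parcs G)" "pverts G = {..<n}"
  shows "G \<in> graphs_of_order n"
proof -
  have "pair_graph G"
  proof unfold_locales
    show "finite (parcs G)" by (rule simple_on_finite[OF assms(1)])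
    show "symmetric (with_proj G)" using assms(1) unfolding simple_on_def symmetric_def by simp
  qed (use assms simple_onD[OF assms(1)] in auto)
  then show ?thesis using assms(2) unfolding graphs_of_order_def by simp
qed

lemma finite_graphs_of_order: "finite (graphs_of_order n)"
proof -
  have "graphs_of_order n \<subseteq> (\<lambda>E. \<lparr>pverts = {..<n}, parcs = E\<rparr>) ` Pow ({..<n} \<times> {..<n})"
  proof
    fix G assume G: "G \<in> graphs_of_order n"
    have "G = \<lparr>pverts = {..<n}, parcs = parcs G\<rparr>" using graphs_of_orderD(2)[OF G] by simp
    moreover have "parcs G \<in> Pow ({..<n} \<times> {..<n})"
      using graphs_of_orderD(1)[OF G] unfolding simple_on_def by simp
    ultimately show "G \<in> (\<lambda>E. \<lparr>pverts = {..<n}, parcs = E\<rparr>) ` Pow ({..<n} \<times> {..<n})" by blast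
  qed
  then show ?thesis by (rule finite_subset) simp
qed

lemma degree_of_eq_deg: "degree_of G v = deg (parcs G) v"
proof -
  have "bij_betw snd {e \<in> parcs G. fst e = v} (parcs G `` {v})"
    unfolding bij_betw_def inj_on_def by force
  then show ?thesis
    unfolding degree_of_def out_degree_def out_arcs_def deg_def by (simp add: bij_betw_same_card)
qed

lemma min_degree_ge_iff:
  assumes "G \<in> graphs_of_order n" "1 \<le> n"
  shows "k \<le> min_degree G \<longleftrightarrow> (\<forall>v<n. k \<le> deg (parcs G) v)"
proof -
  have "{..<n} \<noteq> {}" using assms(2) by (simp add: lessThan_empty_iff)
  then show ?thesis
    unfolding min_degree_def graphs_of_orderD(2)[OF assms(1)] by (subst Min_ge_iff) (auto simp: degree_of_eq_deg)
qed

lemma graph_rho_eq_top_eigenvalue: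
  assumes "G \<in> graphs_of_order n"
  shows "graph_rho G = top_eigenvalue n (wmat 0 (parcs G))"
proof -
  have "adjacency_matrix G = Matrix.mat n n (\<lambda>(i, j). wmat 0 (parcs G) i j)"
    unfolding adjacency_matrix_def graphs_of_orderD(3)[OF assms] by (rule cong_mat) (auto simp: wmat_def)
  then show ?thesis unfolding graph_rho_def top_eigenvalue_def by simp
qed

lemma graph_q_eq_top_eigenvalue:
  assumes "G \<in> graphs_of_order n"
  shows "graph_q G = top_eigenvalue n (wmat 1 (parcs G))"
proof -
  have "signless_laplacian G = Matrix.mat n n (\<lambda>(i, j). wmat 1 (parcs G) i j)"
    unfolding signless_laplacian_def degree_matrix_def adjacency_matrix_def graphs_of_orderD(3)[OF assms]
    by (rule eq_matI) (auto simp: wmat_def degree_of_eq_deg)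
  then show ?thesis unfolding graph_q_def top_eigenvalue_def by simp
qed

lemma contains_spanning_copy_iff:
  assumes F: "F \<in> graphs_of_order n" and G: "G \<in> graphs_of_order n"
  shows "contains_copy F G \<longleftrightarrow>
    (\<exists>f. bij_betw f {..<n} {..<n} \<and> (\<forall>i j. (i, j) \<in> parcs F \<longrightarrow> (f i, f j) \<in> parcs G))"
proof
  assume "contains_copy F G"
  then obtain H hom where H: "subgraph H (with_proj G)" "H = app_iso hom (with_proj F)"
    and hom: "pre_digraph.digraph_isomorphism (with_proj F) hom"
    unfolding contains_copy_def digraph_iso_def by blast
  let ?f = "iso_verts hom"
  have "inj_on ?f {..<n}"
    using hom graphs_of_orderD(2)[OF F] unfolding pre_digraph.digraph_isomorphism_def by simp
  moreover have "?f ` {..<n} \<subseteq> {..<n}"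
    using H graphs_of_orderD(2)[OF F] graphs_of_orderD(2)[OF G] unfolding subgraph_def by simp
  ultimately have "bij_betw ?f {..<n} {..<n}" by (simp add: bij_betw_def endo_inj_surj)
  moreover have "(?f i, ?f j) \<in> parcs G" if ij: "(i, j) \<in> parcs F" for i j
  proof -
    \<comment> \<open>A subgraph shares tail and head functions with its host, and those of the
      image digraph are the ones stored in \<open>hom\<close>. So image arcs are honest pairs, with
      the images of \<open>i\<close> and \<open>j\<close> as components.\<close>
    have "iso_tail hom = fst" "iso_head hom = snd"
      using H unfolding subgraph_def compatible_def by auto
    then have "?f i = fst (iso_arcs hom (i, j))" "?f j = snd (iso_arcs hom (i, j))"
      using hom ij unfolding pre_digraph.digraph_isomorphism_def by force+
    moreover have "iso_arcs hom (i, j) \<in> parcs G" using H ij unfolding subgraph_def by auto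
    ultimately show ?thesis by simp
  qed
  ultimately show "\<exists>f. bij_betw f {..<n} {..<n} \<and> (\<forall>i j. (i, j) \<in> parcs F \<longrightarrow> (f i, f j) \<in> parcs G)" by blast
next
  assume "\<exists>f. bij_betw f {..<n} {..<n} \<and> (\<forall>i j. (i, j) \<in> parcs F \<longrightarrow> (f i, f j) \<in> parcs G)"
  then obtain f where f: "bij_betw f {..<n} {..<n}" and arcs: "\<And>i j. (i, j) \<in> parcs F \<Longrightarrow> (f i, f j) \<in> parcs G"
    by blast
  interpret F: pair_graph F using F unfolding graphs_of_order_def by simp
  interpret G: pair_graph G using G unfolding graphs_of_order_def by simp
  have VF: "pverts F = {..<n}" and VG: "pverts G = {..<n}" using graphs_of_orderD(2) F G by auto
  have inj: "inj_on f (pverts F)" using f VF by (simp add: bij_betw_def)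
  define hom where "hom = \<lparr>iso_verts = f, iso_arcs = map_prod f f, iso_head = snd, iso_tail = fst\<rparr>"
  have "inj_on (map_prod f f) (pverts F \<times> pverts F)" using inj by (rule map_prod_inj_on[OF _ inj])
  then have "inj_on (map_prod f f) (parcs F)" by (rule inj_on_subset) (auto dest: F.wellformed')
  then have iso: "pre_digraph.digraph_isomorphism (with_proj F) hom"
    using inj F.wf_digraph_axioms unfolding pre_digraph.digraph_isomorphism_def hom_def by auto
  have "wf_digraph (app_iso hom (with_proj F))"
    using wf_digraph.wf_digraphI_app_iso[OF F.wf_digraph_axioms iso] .
  then have "subgraph (app_iso hom (with_proj F)) (with_proj G)"
    using G.wf_digraph_axioms f arcs VF VG
    unfolding subgraph_def compatible_def by (auto simp: hom_def bij_betw_def)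
  moreover have "digraph_iso (with_proj F) (app_iso hom (with_proj F))"
    unfolding digraph_iso_def using iso by blast
  ultimately show "contains_copy F G" unfolding contains_copy_def by blast
qed

lemma iso_class_eqI:
  assumes G: "G \<in> graphs_of_order n" and H: "H \<in> graphs_of_order n"
    and \<pi>: "bij_betw \<pi> {..<n} {..<n}" and arcs: "\<And>i j. i < n \<Longrightarrow> j < n \<Longrightarrow> (\<pi> i, \<pi> j) \<in> parcs G \<longleftrightarrow> (i, j) \<in> parcs H"
  shows "iso_class G = iso_class H"
proof -
  interpret G: pair_graph G using G unfolding graphs_of_order_def by simp
  interpret H: pair_graph H using H unfolding graphs_of_order_def by simp
  have VG: "pverts G = {..<n}" and VH: "pverts H = {..<n}" using graphs_of_orderD(2) G H by auto
  have inj: "inj_on \<pi> (pverts H)" using \<pi> VH by (simp add: bij_betw_def)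
  define hom where "hom = \<lparr>iso_verts = \<pi>, iso_arcs = map_prod \<pi> \<pi>, iso_head = snd, iso_tail = fst\<rparr>"
  have "inj_on (map_prod \<pi> \<pi>) (pverts H \<times> pverts H)" using inj by (rule map_prod_inj_on[OF _ inj])
  then have "inj_on (map_prod \<pi> \<pi>) (parcs H)" by (rule inj_on_subset) (auto dest: H.wellformed')
  then have iso: "pre_digraph.digraph_isomorphism (with_proj H) hom"
    using inj H.wf_digraph_axioms unfolding pre_digraph.digraph_isomorphism_def hom_def by auto
  have "parcs G \<subseteq> map_prod \<pi> \<pi> ` parcs H"
  proof
    fix e assume e: "e \<in> parcs G"
    obtain u v where uv: "e = (u, v)" by (cases e)
    then have "u \<in> \<pi> ` {..<n}" "v \<in> \<pi> ` {..<n}" using e G.wellformed' VG \<pi> by (auto simp: bij_betw_def)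
    then obtain i j where "i < n" "j < n" "u = \<pi> i" "v = \<pi> j" by auto
    then show "e \<in> map_prod \<pi> \<pi> ` parcs H" using e uv arcs by force
  qed
  moreover have "map_prod \<pi> \<pi> ` parcs H \<subseteq> parcs G" using arcs H.wellformed' VH by auto
  ultimately have "map_prod \<pi> \<pi> ` parcs H = parcs G" by simp
  then have "with_proj G = app_iso hom (with_proj H)"
    using \<pi> VG VH unfolding hom_def app_iso_def with_proj_def by (simp add: bij_betw_def)
  then have HG: "digraph_iso (with_proj H) (with_proj G)" unfolding digraph_iso_def using iso by blast
  then have "digraph_iso (with_proj G) (with_proj H)" using digraph_iso_swap H.wf_digraph_axioms by blast
  then show ?thesis
    unfolding iso_class_def graphs_of_orderD(3)[OF G] graphs_of_orderD(3)[OF H]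
    using HG digraph_iso_trans by blast
qed

section \<open>The extremal graphs\<close>

text \<open>Common shape of \<open>H_graph\<close> (with \<open>a = s\<close>) and
  \<open>L_graph\<close> (with \<open>a = s - 1\<close>); the free third parameter avoids truncated
  subtraction.\<close>

definition join_graph :: "nat \<Rightarrow> nat \<Rightarrow> nat \<Rightarrow> ngraph" where
  "join_graph a s r = graph_join (complete_graph a) (disjoint_union (edgeless_graph s) (complete_graph r))"

lemma pverts_join_graph: "pverts (join_graph a s r) = {..<a + s + r}"
proof -
  have shift: "(+) m ` {..<l} = {m..<m + l}" for m l :: nat by (simp add: lessThan_atLeast0 add.commute)
  show ?thesis
    unfolding join_graph_def graph_join_def disjoint_union_def shift_graph_def complete_graph_def
      edgeless_graph_def graph_order_def Let_def
    by (auto simp: shift image_Un)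
qed

lemma parcs_join_graph:
  "parcs (join_graph a s r) = {(i, j). i < a + s + r \<and> j < a + s + r \<and> i \<noteq> j
    \<and> (i < a \<or> j < a \<or> a + s \<le> i \<and> a + s \<le> j)}"
proof -
  have shift: "(+) m ` {..<l} = {m..<m + l}" for m l :: nat by (simp add: lessThan_atLeast0 add.commute)
  have shift2: "map_prod ((+) m) ((+) m) ` {(i, j). i < l \<and> j < l \<and> i \<noteq> j} =
    {(i, j). m \<le> i \<and> m \<le> j \<and> i < m + l \<and> j < m + l \<and> i \<noteq> j}" for m l :: nat
  proof (rule subset_antisym; rule subsetI)
    fix e assume "e \<in> {(i, j). m \<le> i \<and> m \<le> j \<and> i < m + l \<and> j < m + l \<and> i \<noteq> j}"
    then have "e = map_prod ((+) m) ((+) m) (fst e - m, snd e - m)"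
      "(fst e - m, snd e - m) \<in> {(i, j). i < l \<and> j < l \<and> i \<noteq> j}" by auto
    then show "e \<in> map_prod ((+) m) ((+) m) ` {(i, j). i < l \<and> j < l \<and> i \<noteq> j}" by (rule image_eqI)
  qed auto
  have shift3: "map_prod ((+) a) ((+) a) ` {(i, j). s \<le> i \<and> s \<le> j \<and> i < s + r \<and> j < s + r \<and> i \<noteq> j} =
    {(i, j). a + s \<le> i \<and> a + s \<le> j \<and> i < a + s + r \<and> j < a + s + r \<and> i \<noteq> j}"
  proof (rule subset_antisym; rule subsetI)
    fix e assume "e \<in> {(i, j). a + s \<le> i \<and> a + s \<le> j \<and> i < a + s + r \<and> j < a + s + r \<and> i \<noteq> j}"
    then have "e = map_prod ((+) a) ((+) a) (fst e - a, snd e - a)"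
      "(fst e - a, snd e - a) \<in> {(i, j). s \<le> i \<and> s \<le> j \<and> i < s + r \<and> j < s + r \<and> i \<noteq> j}" by auto
    then show "e \<in> map_prod ((+) a) ((+) a) ` {(i, j). s \<le> i \<and> s \<le> j \<and> i < s + r \<and> j < s + r \<and> i \<noteq> j}"
      by (rule image_eqI)
  qed auto
  show ?thesis
    unfolding join_graph_def graph_join_def disjoint_union_def shift_graph_def complete_graph_def
      edgeless_graph_def graph_order_def Let_def
    by (auto simp: shift shift2 shift3 image_Un)
qed

lemma join_graph_in_graphs_of_order:
  assumes "n = a + s + r"
  shows "join_graph a s r \<in> graphs_of_order n"
  by (rule graphs_of_orderI)
    (auto simp: assms pverts_join_graph parcs_join_graph simple_on_def sym_def irrefl_def)

lemma threshold_rel_relabel_join_graph: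
  assumes n: "n = a + s + r"
  obtains \<tau> where "bij_betw \<tau> {..<n} {..<n}"
    "\<And>i j. i < n \<Longrightarrow> j < n \<Longrightarrow> (\<tau> i, \<tau> j) \<in> parcs (join_graph a s r) \<longleftrightarrow> (i, j) \<in> threshold_rel n a s"
proof -
  \<comment> \<open>Exchanges the block of \<open>r\<close> clique vertices with the block of
    \<open>s\<close> independent vertices, keeping the order inside each.\<close>
  define \<tau> where "\<tau> i = (if i < a then i else if i < a + r then i + s else i - r)" for i
  have "inj_on \<tau> {..<n}" unfolding \<tau>_def n by (rule inj_onI) (auto split: if_splits)
  moreover have "\<tau> ` {..<n} \<subseteq> {..<n}" unfolding \<tau>_def n by auto
  ultimately have bij: "bij_betw \<tau> {..<n} {..<n}" by (simp add: bij_betw_def endo_inj_surj)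
  have "(\<tau> i, \<tau> j) \<in> parcs (join_graph a s r) \<longleftrightarrow> (i, j) \<in> threshold_rel n a s" if "i < n" "j < n" for i j
  proof -
    have ij: "\<tau> i < n" "\<tau> j < n" "\<tau> i = \<tau> j \<longleftrightarrow> i = j"
      using bij that by (auto simp: bij_betw_def inj_on_eq_iff)
    have "\<tau> l < a \<longleftrightarrow> l < a" "a + s \<le> \<tau> l \<longleftrightarrow> a \<le> l \<and> l < a + r" if "l < n" for l
      using that unfolding \<tau>_def n by auto
    then show ?thesis
      using ij that unfolding parcs_join_graph threshold_rel_def by (auto simp: n)
  qed
  with bij show thesis by (rule that)
qed

lemma le_deg_join_graph:
  assumes n: "n = a + s + r" and r: "1 \<le> r" and v: "v < n"
  shows "a \<le> deg (parcs (join_graph a s r)) v"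
proof -
  have fin: "finite (parcs (join_graph a s r) `` {v})"
    using simple_on_finite[OF graphs_of_orderD(1)[OF join_graph_in_graphs_of_order[OF n]]]
    by (rule finite_Image)
  show ?thesis
  proof (cases "v < a")
    case True
    \<comment> \<open>A dominating vertex misses itself among the first \<open>a\<close>; the clique
      vertex \<open>a + s\<close>, present because \<open>r \<ge> 1\<close>, makes up for
      it.\<close>
    then have "insert (a + s) ({..<a} - {v}) \<subseteq> parcs (join_graph a s r) `` {v}"
      using r by (auto simp: parcs_join_graph)
    then have "card (insert (a + s) ({..<a} - {v})) \<le> deg (parcs (join_graph a s r)) v"
      unfolding deg_def using fin by (intro card_mono)
    then show ?thesis using True by simp
  next
    case False
    then have "{..<a} \<subseteq> parcs (join_graph a s r) `` {v}"
      using v by (auto simp: parcs_join_graph n)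
    then have "card {..<a} \<le> deg (parcs (join_graph a s r)) v"
      unfolding deg_def using fin by (intro card_mono)
    then show ?thesis by simp
  qed
qed

text \<open>The \<open>s\<close> independent vertices have only the \<open>a \<le> s\<close>
  dominating ones as neighbours, and the clique vertex \<open>a + s\<close> lies outside both
  blocks.\<close>

lemma no_ham_cycle_join_graph:
  assumes n: "n = a + s + r" and r: "1 \<le> r" and s: "1 \<le> s" "a \<le> s"
  shows "\<not> ham_cycle n (parcs (join_graph a s r)) f"
proof (rule no_ham_cycle_if_independent[of _ "{a..<a + s}" _ "{..<a}"])
  show "sym (parcs (join_graph a s r))" by (auto simp: sym_def parcs_join_graph)
  have "a + s \<notin> {a..<a + s} \<union> {..<a}" by simp
  moreover have "a + s \<in> {..<n}" using n r by simp
  ultimately show "{a..<a + s} \<union> {..<a} \<noteq> {..<n}" by blast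
  show "v \<in> {..<a}" if "(u, v) \<in> parcs (join_graph a s r)" "u \<in> {a..<a + s}" for u v
    using that by (auto simp: parcs_join_graph)
qed (use n s in auto)

text \<open>In the hub the new vertex \<open>n\<close> counts as one more dominating vertex, which
  is why one more independent vertex is required than for cycles.\<close>

lemma no_ham_path_join_graph:
  assumes n: "n = a + s + r" and r: "1 \<le> r" and s: "1 \<le> s" "Suc a \<le> s"
  shows "\<not> ham_path n (parcs (join_graph a s r)) f"
proof
  assume "ham_path n (parcs (join_graph a s r)) f"
  then obtain g where g: "ham_cycle (Suc n) (hub n (parcs (join_graph a s r))) g"
    using ham_cycle_hub_if_ham_path n s by fastforce
  have "\<not> ham_cycle (Suc n) (hub n (parcs (join_graph a s r))) g"
  proof (rule no_ham_cycle_if_independent[of _ "{a..<a + s}" _ "insert n {..<a}"])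
    show "sym (hub n (parcs (join_graph a s r)))" by (auto simp: sym_def hub_def parcs_join_graph)
    have "a + s \<notin> {a..<a + s} \<union> insert n {..<a}" using n r by simp
    moreover have "a + s \<in> {..<Suc n}" using n r by simp
    ultimately show "{a..<a + s} \<union> insert n {..<a} \<noteq> {..<Suc n}" by blast
    show "v \<in> insert n {..<a}" if "(u, v) \<in> hub n (parcs (join_graph a s r))" "u \<in> {a..<a + s}" for u v
      using that n r by (auto simp: parcs_join_graph hub_def)
  qed (use n s in auto)
  then show False using g by simp
qed

lemma cycle_graph_in_graphs_of_order:
  assumes "2 \<le> n"
  shows "cycle_graph n \<in> graphs_of_order n"
proof (rule graphs_of_orderI)
  have "Suc i mod n \<noteq> i" if "i < n" for i
    using that assms by (cases "Suc i = n") auto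
  then show "simple_on n (parcs (cycle_graph n))"
    unfolding cycle_graph_def simple_on_def sym_def irrefl_def by force
qed (simp add: cycle_graph_def)

lemma path_graph_in_graphs_of_order: "path_graph n \<in> graphs_of_order n"
  by (rule graphs_of_orderI) (auto simp: path_graph_def simple_on_def sym_def irrefl_def)

lemma contains_cycle_iff:
  assumes "2 \<le> n" and G: "G \<in> graphs_of_order n"
  shows "contains_copy (cycle_graph n) G \<longleftrightarrow> (\<exists>f. ham_cycle n (parcs G) f)"
proof -
  note sym = simple_onD(3)[OF graphs_of_orderD(1)[OF G]]
  have "(\<forall>i j. (i, j) \<in> parcs (cycle_graph n) \<longrightarrow> (f i, f j) \<in> parcs G) \<longleftrightarrow>
    (\<forall>i<n. (f i, f (Suc i mod n)) \<in> parcs G)" for f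
    using assms(1) sym unfolding cycle_graph_def by auto
  then show ?thesis
    unfolding contains_spanning_copy_iff[OF cycle_graph_in_graphs_of_order[OF assms(1)] G] ham_cycle_def by simp
qed

lemma contains_path_iff:
  assumes G: "G \<in> graphs_of_order n"
  shows "contains_copy (path_graph n) G \<longleftrightarrow> (\<exists>f. ham_path n (parcs G) f)"
proof -
  note sym = simple_onD(3)[OF graphs_of_orderD(1)[OF G]]
  have "(\<forall>i j. (i, j) \<in> parcs (path_graph n) \<longrightarrow> (f i, f j) \<in> parcs G) \<longleftrightarrow>
    (\<forall>i. Suc i < n \<longrightarrow> (f i, f (Suc i)) \<in> parcs G)" for f
    using sym unfolding path_graph_def by auto
  then show ?thesis
    unfolding contains_spanning_copy_iff[OF path_graph_in_graphs_of_order G] ham_path_def by simp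
qed

lemma lam_eq_top_eigenvalue:
  assumes "lam \<in> {graph_rho, graph_q}"
  obtains \<theta> where "0 \<le> \<theta>" "\<And>n G. G \<in> graphs_of_order n \<Longrightarrow> lam G = top_eigenvalue n (wmat \<theta> (parcs G))"
  using assms graph_rho_eq_top_eigenvalue graph_q_eq_top_eigenvalue
  by (metis empty_iff insert_iff order_refl zero_le_one)

lemma lam_le_join_graph:
  assumes lam: "lam \<in> {graph_rho, graph_q}" and G: "G \<in> graphs_of_order n"
    and n: "n = a + s + r" and a: "1 \<le> a" and r: "1 \<le> r"
    and low: "s \<le> card {i. i < n \<and> deg (parcs G) i \<le> a}"
    and mid: "n - a \<le> card {i. i < n \<and> deg (parcs G) i < n - s}"
  shows "lam G \<le> lam (join_graph a s r)"
    and "lam G = lam (join_graph a s r) \<Longrightarrow> iso_class G = iso_class (join_graph a s r)"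
proof -
  let ?J = "join_graph a s r" and ?T = "threshold_rel n a s"
  obtain \<theta> where \<theta>: "0 \<le> \<theta>" "\<And>n G. G \<in> graphs_of_order n \<Longrightarrow> lam G = top_eigenvalue n (wmat \<theta> (parcs G))"
    using lam_eq_top_eigenvalue[OF lam] by blast
  note J = join_graph_in_graphs_of_order[OF n]
  have as: "a + s < n" using n r by simp
  obtain \<tau> where \<tau>: "bij_betw \<tau> {..<n} {..<n}"
    "\<And>i j. i < n \<Longrightarrow> j < n \<Longrightarrow> (\<tau> i, \<tau> j) \<in> parcs ?J \<longleftrightarrow> (i, j) \<in> ?T"
    using threshold_rel_relabel_join_graph[OF n] by blast
  \<comment> \<open>The comparison speaks of the sorted labelling. \<open>T\<close> carries that
    labelling as a graph and links \<open>G\<close> to the differently labelled join.\<close>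
  define T where "T = \<lparr>pverts = {..<n}, parcs = ?T\<rparr>"
  have T: "T \<in> graphs_of_order n" by (rule graphs_of_orderI) (auto simp: T_def simple_on_threshold_rel)
  have JT: "iso_class ?J = iso_class T"
    by (rule iso_class_eqI[OF J T \<tau>(1)]) (simp add: \<tau>(2) T_def)
  have lamJ: "lam ?J = top_eigenvalue n (wmat \<theta> ?T)"
    unfolding \<theta>(2)[OF J]
    by (rule top_eigenvalue_relabel[OF \<tau>(1), symmetric])
      (rule wmat_relabel[OF graphs_of_orderD(1)[OF J] simple_on_threshold_rel \<tau>])
  note bound = top_eigenvalue_le_threshold[OF graphs_of_orderD(1)[OF G] a as \<theta>(1) low mid]
  show "lam G \<le> lam ?J" using bound(1) unfolding lamJ \<theta>(2)[OF G] .
  assume "lam G = lam ?J"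
  then obtain \<pi> where "bij_betw \<pi> {..<n} {..<n}" "\<forall>i<n. \<forall>j<n. (\<pi> i, \<pi> j) \<in> parcs G \<longleftrightarrow> (i, j) \<in> ?T"
    using bound(2) unfolding lamJ \<theta>(2)[OF G] by blast
  then have "iso_class G = iso_class T" by (intro iso_class_eqI[OF G T]) (auto simp: T_def)
  then show "iso_class G = iso_class ?J" using JT by simp
qed

section \<open>Extremal values and extremal families\<close>

text \<open>The end of the argument shared by cycles and paths: once every admissible graph is
  dominated by a family member, strictly unless isomorphic to it, value and extremal classes can be
  read off from the family.\<close>

lemma spex_and_SPEX_eq:
  fixes K :: "nat \<Rightarrow> ngraph"
  assumes I: "finite I" "I \<noteq> {}" and adm: "\<And>s. s \<in> I \<Longrightarrow> K s \<in> admissible_graphs n F k"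
    and bound: "\<And>G. G \<in> admissible_graphs n F k \<Longrightarrow>
      \<exists>s\<in>I. lam G \<le> lam (K s) \<and> (lam G = lam (K s) \<longrightarrow> iso_class G = iso_class (K s))"
  shows "spex lam n F k = Max ((\<lambda>s. lam (K s)) ` I)"
    and "SPEX lam n F k = {iso_class (K s) | s. s \<in> I \<and> lam (K s) = spex lam n F k}"
proof -
  have fin: "finite (admissible_graphs n F k)"
    by (rule finite_subset[OF _ finite_graphs_of_order[of n]]) (auto simp: admissible_graphs_def)
  have le: "lam G \<le> spex lam n F k" if "G \<in> admissible_graphs n F k" for G
    unfolding spex_def using fin that by (intro Max_ge) auto
  show "spex lam n F k = Max ((\<lambda>s. lam (K s)) ` I)"
    unfolding spex_def
  proof (rule antisym)
    show "Max (lam ` admissible_graphs n F k) \<le> Max ((\<lambda>s. lam (K s)) ` I)"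
    proof (rule Max.boundedI)
      fix m assume "m \<in> lam ` admissible_graphs n F k"
      then obtain s where "s \<in> I" "m \<le> lam (K s)" using bound by blast
      then show "m \<le> Max ((\<lambda>s. lam (K s)) ` I)" using I(1) by (intro Max_ge_iff[THEN iffD2]) auto
    qed (use fin adm I in auto)
    show "Max ((\<lambda>s. lam (K s)) ` I) \<le> Max (lam ` admissible_graphs n F k)"
      using fin adm I by (intro Max_mono) auto
  qed
  show "SPEX lam n F k = {iso_class (K s) | s. s \<in> I \<and> lam (K s) = spex lam n F k}"
  proof (rule subset_antisym; rule subsetI)
    fix c assume "c \<in> SPEX lam n F k"
    then obtain G where G: "G \<in> admissible_graphs n F k" "lam G = spex lam n F k" "c = iso_class G"
      unfolding SPEX_def by blast
    obtain s where s: "s \<in> I" "lam G \<le> lam (K s)" "lam G = lam (K s) \<longrightarrow> iso_class G = iso_class (K s)"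
      using bound[OF G(1)] by blast
    \<comment> \<open>The dominating member is itself admissible, so it cannot exceed the extremal
      \<open>G\<close>; the resulting equality makes the two isomorphic.\<close>
    then have "lam (K s) = spex lam n F k" using le[OF adm[OF s(1)]] G(2) by simp
    then show "c \<in> {iso_class (K s) | s. s \<in> I \<and> lam (K s) = spex lam n F k}" using G s by auto
  next
    fix c assume "c \<in> {iso_class (K s) | s. s \<in> I \<and> lam (K s) = spex lam n F k}"
    then show "c \<in> SPEX lam n F k" unfolding SPEX_def using adm by blast
  qed
qed

lemma ham_path_complete: "ham_path n {(i, j). i < n \<and> j < n \<and> i \<noteq> j} id"
  unfolding ham_path_def by auto

lemma ham_cycle_complete: "2 \<le> n \<Longrightarrow> ham_cycle n {(i, j). i < n \<and> j < n \<and> i \<noteq> j} id"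
  using cycle_graph_in_graphs_of_order[of n, THEN graphs_of_orderD(1)]
  unfolding ham_cycle_def cycle_graph_def by (auto dest: simple_onD(4))

lemma spex_cycle:
  assumes k: "1 \<le> k" and lam: "lam \<in> {graph_rho, graph_q}" and n: "2 * k + 1 \<le> n"
  shows "spex lam n (cycle_graph n) k = Max ((\<lambda>s. lam (H_graph n s)) ` {k..(n - 1) div 2})"
    and "SPEX lam n (cycle_graph n) k =
      {iso_class (H_graph n s) | s. s \<in> {k..(n - 1) div 2} \<and> lam (H_graph n s) = spex lam n (cycle_graph n) k}"
proof -
  have n3: "3 \<le> n" using k n by simp
  have K: "H_graph n s = join_graph s s (n - 2 * s)" for s unfolding H_graph_def join_graph_def ..
  have adm: "H_graph n s \<in> admissible_graphs n (cycle_graph n) k" if "s \<in> {k..(n - 1) div 2}" for s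
  proof -
    have ns: "n = s + s + (n - 2 * s)" "1 \<le> n - 2 * s" "1 \<le> s" "k \<le> s" using that k n by auto
    note J = join_graph_in_graphs_of_order[OF ns(1)]
    have "k \<le> min_degree (H_graph n s)"
      unfolding K using n3 ns(4) le_deg_join_graph[OF ns(1,2)] by (subst min_degree_ge_iff[OF J]) (auto intro: order_trans)
    moreover have "\<not> contains_copy (cycle_graph n) (H_graph n s)"
      unfolding K using n3 no_ham_cycle_join_graph[OF ns(1-3) order_refl] by (subst contains_cycle_iff[OF _ J]) auto
    ultimately show ?thesis unfolding admissible_graphs_def using J K by simp
  qed
  have bound: "\<exists>s\<in>{k..(n - 1) div 2}. lam G \<le> lam (H_graph n s)
      \<and> (lam G = lam (H_graph n s) \<longrightarrow> iso_class G = iso_class (H_graph n s))"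
    if "G \<in> admissible_graphs n (cycle_graph n) k" for G
  proof -
    have G: "G \<in> graphs_of_order n" and deg: "\<And>v. v < n \<Longrightarrow> k \<le> deg (parcs G) v"
      and ham: "\<nexists>f. ham_cycle n (parcs G) f"
      using that n3 min_degree_ge_iff contains_cycle_iff unfolding admissible_graphs_def by auto
    \<comment> \<open>The instance \<open>t = 0\<close> of \<open>chvatal_degrees\<close>, with the
      zeros kept so that the rule matches.\<close>
    have "\<exists>a\<ge>k. 2 * a + 0 < n \<and> a + 0 \<le> card {w. w < n \<and> deg (parcs G) w \<le> a}
        \<and> n - a \<le> card {w. w < n \<and> deg (parcs G) w < n - (a + 0)}"
    proof (rule chvatal_degrees[where P = "\<lambda>E. \<nexists>f. ham_cycle n E f", OF graphs_of_orderD(1)[OF G] ham deg])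
      show "\<not> (\<nexists>f. ham_cycle n {(i, j). i < n \<and> j < n \<and> i \<noteq> j} f)"
        using ham_cycle_complete[of n] n3 by fastforce
    next
      fix E u v
      assume E: "simple_on n E" and "\<nexists>f. ham_cycle n E f" "u < n" "v < n" "u \<noteq> v" "n - 0 \<le> deg E u + deg E v"
      then show "\<nexists>f. ham_cycle n (add_edge E u v) f"
        using ham_cycle_add_edge[OF E, of u v] n3 by auto
    qed
    then obtain a where a: "k \<le> a" "2 * a < n" "a \<le> card {w. w < n \<and> deg (parcs G) w \<le> a}"
      "n - a \<le> card {w. w < n \<and> deg (parcs G) w < n - a}" by auto
    have "n = a + a + (n - 2 * a)" "1 \<le> a" "1 \<le> n - 2 * a" using a k by auto
    from lam_le_join_graph[OF lam G this a(3,4)] show ?thesis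
      unfolding K using a by (intro bexI[of _ a]) auto
  qed
  have I: "finite {k..(n - 1) div 2}" "{k..(n - 1) div 2} \<noteq> {}" using n by auto
  show "spex lam n (cycle_graph n) k = Max ((\<lambda>s. lam (H_graph n s)) ` {k..(n - 1) div 2})"
    by (rule spex_and_SPEX_eq(1)[OF I adm bound])
  show "SPEX lam n (cycle_graph n) k =
      {iso_class (H_graph n s) | s. s \<in> {k..(n - 1) div 2} \<and> lam (H_graph n s) = spex lam n (cycle_graph n) k}"
    by (rule spex_and_SPEX_eq(2)[OF I adm bound])
qed

lemma spex_path:
  assumes k: "1 \<le> k" and lam: "lam \<in> {graph_rho, graph_q}" and n: "2 * k + 2 \<le> n"
  shows "spex lam n (path_graph n) k = Max ((\<lambda>s. lam (L_graph n s)) ` {k + 1..n div 2})"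
    and "SPEX lam n (path_graph n) k =
      {iso_class (L_graph n s) | s. s \<in> {k + 1..n div 2} \<and> lam (L_graph n s) = spex lam n (path_graph n) k}"
proof -
  have n2: "2 \<le> n" using n by simp
  have K: "L_graph n s = join_graph (s - 1) s (n - 2 * s + 1)" for s unfolding L_graph_def join_graph_def ..
  have adm: "L_graph n s \<in> admissible_graphs n (path_graph n) k" if "s \<in> {k + 1..n div 2}" for s
  proof -
    have ns: "n = (s - 1) + s + (n - 2 * s + 1)" "1 \<le> n - 2 * s + 1" "1 \<le> s" "Suc (s - 1) \<le> s" "k \<le> s - 1"
      using that k n by auto
    note J = join_graph_in_graphs_of_order[OF ns(1)]
    have "k \<le> min_degree (L_graph n s)"
      unfolding K using n2 ns(5) le_deg_join_graph[OF ns(1,2)] by (subst min_degree_ge_iff[OF J]) (auto intro: order_trans)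
    moreover have "\<not> contains_copy (path_graph n) (L_graph n s)"
      unfolding K using no_ham_path_join_graph[OF ns(1-4)] by (subst contains_path_iff[OF J]) auto
    ultimately show ?thesis unfolding admissible_graphs_def using J K by simp
  qed
  have bound: "\<exists>s\<in>{k + 1..n div 2}. lam G \<le> lam (L_graph n s)
      \<and> (lam G = lam (L_graph n s) \<longrightarrow> iso_class G = iso_class (L_graph n s))"
    if "G \<in> admissible_graphs n (path_graph n) k" for G
  proof -
    have G: "G \<in> graphs_of_order n" and deg: "\<And>v. v < n \<Longrightarrow> k \<le> deg (parcs G) v"
      and ham: "\<nexists>f. ham_path n (parcs G) f"
      using that n2 min_degree_ge_iff contains_path_iff unfolding admissible_graphs_def by auto
    have "\<exists>a\<ge>k. 2 * a + 1 < n \<and> a + 1 \<le> card {w. w < n \<and> deg (parcs G) w \<le> a}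
        \<and> n - a \<le> card {w. w < n \<and> deg (parcs G) w < n - (a + 1)}"
    proof (rule chvatal_degrees[where P = "\<lambda>E. \<nexists>f. ham_path n E f", OF graphs_of_orderD(1)[OF G] ham deg])
      show "\<not> (\<nexists>f. ham_path n {(i, j). i < n \<and> j < n \<and> i \<noteq> j} f)"
        using ham_path_complete[of n] by blast
    next
      fix E u v
      assume E: "simple_on n E" and "\<nexists>f. ham_path n E f" "u < n" "v < n" "u \<noteq> v" "n - 1 \<le> deg E u + deg E v"
      then show "\<nexists>f. ham_path n (add_edge E u v) f"
        using ham_path_add_edge[OF E, of u v] n2 by auto
    qed
    then obtain a where a: "k \<le> a" "2 * a + 1 < n" "a + 1 \<le> card {w. w < n \<and> deg (parcs G) w \<le> a}"
      "n - a \<le> card {w. w < n \<and> deg (parcs G) w < n - (a + 1)}" by auto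
    \<comment> \<open>The path case has \<open>t = 1\<close>, so the independent block has
      \<open>a + 1\<close> vertices and the index of the \<open>L_graph\<close> is
      \<open>s = a + 1\<close>; \<open>2 * a + 1 < n\<close> places it within
      \<open>n div 2\<close>.\<close>
    have "n = a + (a + 1) + (n - 2 * (a + 1) + 1)" "1 \<le> a" "1 \<le> n - 2 * (a + 1) + 1" using a k by auto
    from lam_le_join_graph[OF lam G this a(3,4)] show ?thesis
      unfolding K using a by (intro bexI[of _ "a + 1"]) auto
  qed
  have I: "finite {k + 1..n div 2}" "{k + 1..n div 2} \<noteq> {}" using n by auto
  show "spex lam n (path_graph n) k = Max ((\<lambda>s. lam (L_graph n s)) ` {k + 1..n div 2})"
    by (rule spex_and_SPEX_eq(1)[OF I adm bound])
  show "SPEX lam n (path_graph n) k =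
      {iso_class (L_graph n s) | s. s \<in> {k + 1..n div 2} \<and> lam (L_graph n s) = spex lam n (path_graph n) k}"
    by (rule spex_and_SPEX_eq(2)[OF I adm bound])
qed

theorem theorem2p7:
  fixes k :: nat and lam :: "ngraph \<Rightarrow> real"
  assumes "k \<ge> 1" and "lam \<in> {graph_rho, graph_q}"
  shows
    "(\<forall>n \<ge> 2 * k + 1.
        spex lam n (cycle_graph n) k = Max ((\<lambda>s. lam (H_graph n s)) ` {k..(n - 1) div 2})
      \<and> SPEX lam n (cycle_graph n) k =
          {iso_class (H_graph n s) | s. k \<le> s \<and> s \<le> (n - 1) div 2
             \<and> lam (H_graph n s) = spex lam n (cycle_graph n) k})
   \<and> (\<forall>n \<ge> 2 * k + 2.
        spex lam n (path_graph n) k = Max ((\<lambda>s. lam (L_graph n s)) ` {k + 1..n div 2})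
      \<and> SPEX lam n (path_graph n) k =
          {iso_class (L_graph n s) | s. k + 1 \<le> s \<and> s \<le> n div 2
             \<and> lam (L_graph n s) = spex lam n (path_graph n) k})"
  using spex_cycle[OF assms] spex_path[OF assms] unfolding atLeastAtMost_iff conj_assoc by blast

end
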